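(* Suppose $n$ is an odd integer with $t_3\leq n<\min\{t_1,t_2\}$, and put $K=k_1+k_2+k_3$. Then: (i) the $\mathfrak{BI}$-module $\mathscr M_n(x_3)$ is isomorphic to $W_1\oplus W_1$, where $W_1=O_{n-t_3}\big(k_1+\tfrac{n+1}{2},\,-K-\tfrac{n+1}{2},\,-k_2-\tfrac{n+1}{2}\big)^{((-1,-1),(1\,3\,2))}$; (ii) the $\mathfrak{BI}$-module $\mathscr M_n/\mathscr M_n(x_3)$ is isomorphic to $W_2\oplus W_2$, where $W_2=O_{t_3-1}(k_1,\,-K-n-1,\,k_2)^{(1\,3\,2)}$. Moreover, if $k_1,k_2\geq0$, then $W_1,W_2$ are irreducible and isomorphic to $O_{n-t_3}\big(-k_2-\tfrac{n+1}{2},\,-k_1-\tfrac{n+1}{2},\,K+\tfrac{n+1}{2}\big)$ and $O_{t_3-1}(k_2,\,k_1,\,-K-n-1)$, respectively.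
   Context: Fix real numbers $k_1,k_2,k_3$. For $i=1,2,3$ let $R_i$ be the operator on functions on $\mathbb R^3$ replacing $x_i$ by $-x_i$, and $T_if=\frac{\partial f}{\partial x_i}+k_i\frac{f-R_if}{x_i}$ (Dunkl operators). Let $\sigma_1=\begin{pmatrix}0&1\\1&0\end{pmatrix}$, $\sigma_2=\begin{pmatrix}0&-\sqrt{-1}\\ \sqrt{-1}&0\end{pmatrix}$, $\sigma_3=\begin{pmatrix}1&0\\0&-1\end{pmatrix}$, and let $e_i$ act on $\mathbb C^2$ by $\sigma_i$. Tensor products are over $\mathbb R$; $\mathbb R[\cdots]_m$ denotes homogeneous polynomials of degree $m$. Let $\mathbf D=e_1\otimes T_1+e_2\otimes T_2+e_3\otimes T_3$ and $\mathscr M_n=\ker(\mathbf D|_{\mathbb C^2\otimes\mathbb R[x_1,x_2,x_3]_n})$. For $i=1,2,3$ set $t_i=-2k_i$ if $2k_i$ is an odd negative integer, and $t_i=\infty$ otherwise. For $i=1,2,3$, $\mathscr M_n(x_i)=\mathscr M_n\cap\bigoplus_{j=t_i}^n\mathbb C^2\otimes(x_i^j\cdot\mathbb R[x_p,x_q]_{n-j})$ where $\{p,q\}=\{1,2,3\}\setminus\{i\}$ (it is $\{0\}$ if $n<t_i$); it is a $\mathfrak{BI}$-submodule of $\mathscr M_n$. $\mathfrak{BI}$ is the unital associative $\mathbb C$-algebra generated by $X,Y,Z$ with relations saying that $\{X,Y\}-Z$, $\{Y,Z\}-X$, $\{Z,X\}-Y$ commute with $X,Y,Z$ ($\{A,B\}=AB+BA$).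 $\mathscr M_n$ is a $\mathfrak{BI}$-module via $X=(\sqrt{-1}\,e_1\otimes(x_3T_2-x_2T_3)+\tfrac12)R_2R_3+k_2R_3+k_3R_2$, $Y=(\sqrt{-1}\,e_2\otimes(x_1T_3-x_3T_1)+\tfrac12)R_1R_3+k_3R_1+k_1R_3$, $Z=(\sqrt{-1}\,e_3\otimes(x_2T_1-x_1T_2)+\tfrac12)R_1R_2+k_1R_2+k_2R_1$, operators composed right to left, $R_i$ acting on the polynomial factor. Twisting: for a $\mathfrak{BI}$-module $V$ and algebra automorphism $\varepsilon$, $V^\varepsilon$ is $V$ with action $x\cdot v=\varepsilon(x)v$. Write $(W_1,W_2,W_3)=(X,Y,Z)$. A permutation $\sigma\in\mathfrak S_3$ denotes the automorphism $W_i\mapsto W_{\sigma(i)}$; the sign automorphisms are $(1,-1)\colon X\mapsto X,Y\mapsto -Y,Z\mapsto -Z$; $(-1,1)\colon X\mapsto -X,Y\mapsto Y,Z\mapsto -Z$; $(-1,-1)\colon X\mapsto -X,Y\mapsto -Y,Z\mapsto Z$; and a pair $(\epsilon,\sigma)$ denotes the composite automorphism $\epsilon\circ\sigma$. For $a,b,c\in\mathbb C$ and even $d\geq0$, $O_d(a,b,c)$ is the $\mathfrak{BI}$-module $\mathbb C^{d+1}$ in which, w.r.t. a basis $v_0,\dots,v_d$, $X$ acts by the lower bidiagonal matrix with diagonal $(\theta_0,\dots,\theta_d)$ and subdiagonal entries $1$, $Y$ by the upper bidiagonal matrix with diagonal $(\theta^*_0,\dots,\theta^*_d)$ and superdiagonal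 $(\varphi_1,\dots,\varphi_d)$, and $Z=\{X,Y\}-(2ab-c(d+1))$, where $\theta_i=\frac{(-1)^i(2a-d+2i)}{2}$, $\theta^*_i=\frac{(-1)^i(2b-d+2i)}{2}$, $\varphi_i=\frac{i(d+1-2i-2a-2b-2c)}{2}$ ($i$ even), $\varphi_i=\frac{(i-d-1)(d+1-2i-2a-2b+2c)}{2}$ ($i$ odd). *)

theory Defs
  imports Complex_Main "HOL-Library.Extended_Nat"
begin

text \<open>A module over the algebra BI (generated by X, Y, Z) is determined by the three
  operators by which X, Y, Z act on the carrier (a complex vector space).  Vectors are
  complex-valued functions on an index type; addition and scalar multiplication are pointwise.\<close>

record 'i bimod =
  bcar :: "('i \<Rightarrow> complex) set"
  actX :: "('i \<Rightarrow> complex) \<Rightarrow> ('i \<Rightarrow> complex)"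
  actY :: "('i \<Rightarrow> complex) \<Rightarrow> ('i \<Rightarrow> complex)"
  actZ :: "('i \<Rightarrow> complex) \<Rightarrow> ('i \<Rightarrow> complex)"

definition vzero :: "'i \<Rightarrow> complex" where "vzero = (\<lambda>_. 0)"

definition clinear_on :: "('i \<Rightarrow> complex) set \<Rightarrow> (('i \<Rightarrow> complex) \<Rightarrow> ('j \<Rightarrow> complex)) \<Rightarrow> bool" where
  "clinear_on V \<phi> \<longleftrightarrow>
     (\<forall>u\<in>V. \<forall>v\<in>V. \<phi> (\<lambda>x. u x + v x) = (\<lambda>y. \<phi> u y + \<phi> v y)) \<and>
     (\<forall>c. \<forall>u\<in>V. \<phi> (\<lambda>x. c * u x) = (\<lambda>y. c * \<phi> u y))"

definition csubspace_of :: "('i \<Rightarrow> complex) set \<Rightarrow> bool" where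
  "csubspace_of U \<longleftrightarrow> vzero \<in> U \<and> (\<forall>u\<in>U. \<forall>v\<in>U. (\<lambda>x. u x + v x) \<in> U) \<and>
     (\<forall>c. \<forall>u\<in>U. (\<lambda>x. c * u x) \<in> U)"

definition intertwines :: "'i bimod \<Rightarrow> 'j bimod \<Rightarrow> (('i \<Rightarrow> complex) \<Rightarrow> ('j \<Rightarrow> complex)) \<Rightarrow> bool" where
  "intertwines M N \<phi> \<longleftrightarrow> (\<forall>v\<in>bcar M.
      \<phi> (actX M v) = actX N (\<phi> v) \<and> \<phi> (actY M v) = actY N (\<phi> v) \<and> \<phi> (actZ M v) = actZ N (\<phi> v))"

definition bi_isomorphic :: "'i bimod \<Rightarrow> 'j bimod \<Rightarrow> bool" where
  "bi_isomorphic M N \<longleftrightarrow> (\<exists>\<phi>. clinear_on (bcar M) \<phi> \<and> bij_betw \<phi> (bcar M) (bcar N) \<and> intertwines M N \<phi>)"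

text \<open>The quotient module M/S is isomorphic to N, expressed via the first isomorphism theorem:
  there is a surjective module homomorphism M \<rightarrow> N whose kernel is exactly S.\<close>
definition bi_quotient_isomorphic :: "'i bimod \<Rightarrow> ('i \<Rightarrow> complex) set \<Rightarrow> 'j bimod \<Rightarrow> bool" where
  "bi_quotient_isomorphic M S N \<longleftrightarrow> (\<exists>\<phi>. clinear_on (bcar M) \<phi> \<and> \<phi> ` bcar M = bcar N \<and>
      {v\<in>bcar M. \<phi> v = vzero} = S \<and> intertwines M N \<phi>)"

definition bi_submodule :: "('i \<Rightarrow> complex) set \<Rightarrow> 'i bimod \<Rightarrow> bool" where
  "bi_submodule U M \<longleftrightarrow> U \<subseteq> bcar M \<and> csubspace_of U \<and>
     (\<forall>v\<in>U. actX M v \<in> U \<and> actY M v \<in> U \<and> actZ M v \<in> U)"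

definition bi_irreducible :: "'i bimod \<Rightarrow> bool" where
  "bi_irreducible M \<longleftrightarrow> bcar M \<noteq> {vzero} \<and>
     (\<forall>U. bi_submodule U M \<longrightarrow> U = {vzero} \<or> U = bcar M)"

definition bi_dsum :: "'i bimod \<Rightarrow> (bool \<times> 'i) bimod" where
  "bi_dsum M = \<lparr> bcar = {v. (\<forall>b. (\<lambda>x. v (b, x)) \<in> bcar M)},
     actX = (\<lambda>v (b, x). actX M (\<lambda>y. v (b, y)) x),
     actY = (\<lambda>v (b, x). actY M (\<lambda>y. v (b, y)) x),
     actZ = (\<lambda>v (b, x). actZ M (\<lambda>y. v (b, y)) x) \<rparr>"

datatype idx = I1 | I2 | I3

definition gen :: "'i bimod \<Rightarrow> idx \<Rightarrow> (('i \<Rightarrow> complex) \<Rightarrow> ('i \<Rightarrow> complex))" where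
  "gen M i = (case i of I1 \<Rightarrow> actX M | I2 \<Rightarrow> actY M | I3 \<Rightarrow> actZ M)"

definition twist_perm :: "(idx \<Rightarrow> idx) \<Rightarrow> 'i bimod \<Rightarrow> 'i bimod" where
  "twist_perm \<sigma> M = \<lparr> bcar = bcar M, actX = gen M (\<sigma> I1), actY = gen M (\<sigma> I2),
     actZ = gen M (\<sigma> I3) \<rparr>"

definition twist_sign :: "complex \<Rightarrow> complex \<Rightarrow> 'i bimod \<Rightarrow> 'i bimod" where
  "twist_sign a b M = \<lparr> bcar = bcar M,
     actX = (\<lambda>v x. a * actX M v x), actY = (\<lambda>v x. b * actY M v x),
     actZ = (\<lambda>v x. a * b * actZ M v x) \<rparr>"

text \<open>Twist by the composite automorphism (\<epsilon>,\<sigma>) = \<epsilon> \<circ> \<sigma>: the generator x acts as \<epsilon>(\<sigma>(x)),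
  i.e. V^(\<epsilon>\<circ>\<sigma>) = (V^\<epsilon>)^\<sigma>.\<close>
definition twist :: "complex \<times> complex \<Rightarrow> (idx \<Rightarrow> idx) \<Rightarrow> 'i bimod \<Rightarrow> 'i bimod" where
  "twist \<epsilon> \<sigma> M = twist_perm \<sigma> (twist_sign (fst \<epsilon>) (snd \<epsilon>) M)"

definition cyc132 :: "idx \<Rightarrow> idx" where
  "cyc132 i = (case i of I1 \<Rightarrow> I3 | I2 \<Rightarrow> I1 | I3 \<Rightarrow> I2)"

definition Otheta :: "nat \<Rightarrow> complex \<Rightarrow> nat \<Rightarrow> complex" where
  "Otheta d a i = (-1) ^ i * (2 * a - of_nat d + 2 * of_nat i) / 2"

definition Ophi :: "nat \<Rightarrow> complex \<Rightarrow> complex \<Rightarrow> complex \<Rightarrow> nat \<Rightarrow> complex" where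
  "Ophi d a b c i = (if even i
      then of_nat i * (of_nat d + 1 - 2 * of_nat i - 2 * a - 2 * b - 2 * c) / 2
      else (of_nat i - of_nat d - 1) * (of_nat d + 1 - 2 * of_nat i - 2 * a - 2 * b + 2 * c) / 2)"

definition OX :: "nat \<Rightarrow> complex \<Rightarrow> (nat \<Rightarrow> complex) \<Rightarrow> (nat \<Rightarrow> complex)" where
  "OX d a v = (\<lambda>i. if i \<le> d then Otheta d a i * v i + (if i \<ge> 1 then v (i - 1) else 0) else 0)"

definition OY :: "nat \<Rightarrow> complex \<Rightarrow> complex \<Rightarrow> complex \<Rightarrow> (nat \<Rightarrow> complex) \<Rightarrow> (nat \<Rightarrow> complex)" where
  "OY d a b c v = (\<lambda>i. if i \<le> d then Otheta d b i * v i + (if i < d then Ophi d a b c (i + 1) * v (i + 1) else 0) else 0)"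

text \<open>O_d(a,b,c) on C^(d+1), realised as functions nat \<Rightarrow> complex supported in {0..d};
  v_i is the i-th basis coordinate.  Z = XY + YX - (2ab - c(d+1)).\<close>
definition Omod :: "nat \<Rightarrow> complex \<Rightarrow> complex \<Rightarrow> complex \<Rightarrow> nat bimod" where
  "Omod d a b c = \<lparr> bcar = {v. \<forall>i>d. v i = 0},
     actX = OX d a,
     actY = OY d a b c,
     actZ = (\<lambda>v i. OX d a (OY d a b c v) i + OY d a b c (OX d a v) i
                   - (2 * a * b - c * (of_nat d + 1)) * v i) \<rparr>"

text \<open>Monomials x1^(a I1) x2^(a I2) x3^(a I3) are exponent functions a :: idx \<Rightarrow> nat.
  An element of C^2 \<otimes>_R R[x1,x2,x3] is identified with its coefficient function
  f :: bool \<times> (idx \<Rightarrow> nat) \<Rightarrow> complex, where f (True, a) resp. f (False, a) is the coefficient of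
  x^a in the first resp. second coordinate of C^2.\<close>

type_synonym vpol = "bool \<times> (idx \<Rightarrow> nat) \<Rightarrow> complex"

definition mdeg :: "(idx \<Rightarrow> nat) \<Rightarrow> nat" where
  "mdeg a = a I1 + a I2 + a I3"

definition Pn :: "nat \<Rightarrow> vpol set" where
  "Pn n = {f. \<forall>s a. f (s, a) \<noteq> 0 \<longrightarrow> mdeg a = n}"

text \<open>Dunkl operator T_i on coefficient functions.  For a monomial x^a with a_i = m:
  d/dx_i x^a = m x^(a - e_i), and (x^a - R_i x^a)/x_i = 2 x^(a-e_i) if m odd, 0 if m even.
  Hence the coefficient of x^b in T_i p is (b_i+1 + 2 k_i [b_i+1 odd]) times that of x^(b+e_i) in p.\<close>
definition dunkl :: "(idx \<Rightarrow> real) \<Rightarrow> idx \<Rightarrow> ((idx \<Rightarrow> nat) \<Rightarrow> complex) \<Rightarrow> ((idx \<Rightarrow> nat) \<Rightarrow> complex)" where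
  "dunkl k i p = (\<lambda>b. (of_nat (b i + 1) + (if odd (b i + 1) then 2 * complex_of_real (k i) else 0))
                       * p (b(i := Suc (b i))))"

definition refl :: "idx \<Rightarrow> ((idx \<Rightarrow> nat) \<Rightarrow> complex) \<Rightarrow> ((idx \<Rightarrow> nat) \<Rightarrow> complex)" where
  "refl i p = (\<lambda>b. (-1) ^ (b i) * p b)"

definition mulx :: "idx \<Rightarrow> ((idx \<Rightarrow> nat) \<Rightarrow> complex) \<Rightarrow> ((idx \<Rightarrow> nat) \<Rightarrow> complex)" where
  "mulx i p = (\<lambda>b. if b i \<ge> 1 then p (b(i := b i - 1)) else 0)"

definition lift :: "(((idx \<Rightarrow> nat) \<Rightarrow> complex) \<Rightarrow> ((idx \<Rightarrow> nat) \<Rightarrow> complex)) \<Rightarrow> vpol \<Rightarrow> vpol" where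
  "lift A f = (\<lambda>(s, b). A (\<lambda>a. f (s, a)) b)"

definition pauli :: "idx \<Rightarrow> vpol \<Rightarrow> vpol" where
  "pauli i f = (\<lambda>(s, b). case i of
       I1 \<Rightarrow> f (\<not> s, b)
     | I2 \<Rightarrow> (if s then - \<i> * f (False, b) else \<i> * f (True, b))
     | I3 \<Rightarrow> (if s then f (True, b) else - f (False, b)))"

definition Dirac :: "(idx \<Rightarrow> real) \<Rightarrow> vpol \<Rightarrow> vpol" where
  "Dirac k f = (\<lambda>x. pauli I1 (lift (dunkl k I1) f) x + pauli I2 (lift (dunkl k I2) f) x
                  + pauli I3 (lift (dunkl k I3) f) x)"

definition Mn :: "(idx \<Rightarrow> real) \<Rightarrow> nat \<Rightarrow> vpol set" where
  "Mn k n = {f \<in> Pn n. Dirac k f = vzero}"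

definition tt :: "(idx \<Rightarrow> real) \<Rightarrow> idx \<Rightarrow> enat" where
  "tt k i = (if (\<exists>m::nat. odd m \<and> 2 * k i = - real m) then enat (nat (- \<lfloor>2 * k i\<rfloor>)) else \<infinity>)"

definition Mnx :: "(idx \<Rightarrow> real) \<Rightarrow> nat \<Rightarrow> idx \<Rightarrow> vpol set" where
  "Mnx k n i = {f \<in> Mn k n. \<forall>s a. f (s, a) \<noteq> 0 \<longrightarrow> tt k i \<le> enat (a i)}"

definition Lop :: "(idx \<Rightarrow> real) \<Rightarrow> idx \<Rightarrow> idx \<Rightarrow> vpol \<Rightarrow> vpol" where
  "Lop k p q f = (\<lambda>x. lift (mulx p \<circ> dunkl k q) f x - lift (mulx q \<circ> dunkl k p) f x)"

definition bigen :: "(idx \<Rightarrow> real) \<Rightarrow> idx \<Rightarrow> idx \<Rightarrow> idx \<Rightarrow> idx \<Rightarrow> idx \<Rightarrow> vpol \<Rightarrow> vpol" where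
  "bigen k i p q u w f = (let g = lift (refl u) (lift (refl w) f) in
     (\<lambda>x. \<i> * pauli i (Lop k p q g) x + g x / 2
          + complex_of_real (k u) * lift (refl w) f x + complex_of_real (k w) * lift (refl u) f x))"

definition polymod :: "(idx \<Rightarrow> real) \<Rightarrow> vpol set \<Rightarrow> (bool \<times> (idx \<Rightarrow> nat)) bimod" where
  "polymod k V = \<lparr> bcar = V,
     actX = bigen k I1 I3 I2 I2 I3,
     actY = bigen k I2 I1 I3 I1 I3,
     actZ = bigen k I3 I2 I1 I1 I2 \<rparr>"

end

theory Submission
  imports Defs "HOL-Library.Function_Algebras"
begin

text \<open>Since \<open>n < t\<^sub>1\<close>, every \<open>\<complex>\<^sup>2\<close>-valued homogeneous polynomial of degree \<open>n\<close> in \<open>x\<^sub>2, x\<^sub>3\<close> extends uniquely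
  to an element of \<open>M\<^sub>n\<close>, so \<open>M\<^sub>n\<close> may be replaced by its restriction to \<open>x\<^sub>1 = 0\<close>. There
  \<open>X\<close>, \<open>Y\<close>, \<open>Z\<close> commute with \<open>e\<^sub>1\<close>, whose two eigenspaces give the two summands, and in the
  monomials \<open>x\<^sub>2\<^bsup>n-c\<^esup> x\<^sub>3\<^bsup>c\<^esup>\<close> the operator \<open>Y\<close> is lower and \<open>Z\<close> upper bidiagonal. The upper entry at
  \<open>c = t\<^sub>3\<close> vanishes: the monomials with \<open>c \<ge> t\<^sub>3\<close> span \<open>M\<^sub>n(x\<^sub>3)\<close>, those with \<open>c < t\<^sub>3\<close> the quotient, and
  after rescaling both are split bases of the asserted modules.

  A proper nonzero submodule of \<open>O\<^sub>d(a, b, c)\<close> contains a \<open>Y\<close>-eigenvector of minimal leading index \<open>s > 0\<close>;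
  comparing two coefficients of \<open>Y X u\<close> shows that one of four linear forms in \<open>s\<close> must vanish, which is
  impossible for \<open>k\<^sub>1, k\<^sub>2 \<ge> 0\<close>. For the last isomorphisms one writes down an eigenvector
  \<open>w\<close> of \<open>Z\<close> in \<open>O\<^sub>d(A, B, C)\<close> that is also an eigenvector of \<open>X \<plusminus> Y\<close>. Sending \<open>v\<^sub>0\<close> to \<open>w\<close> defines a
  homomorphism on the twisted module, as \<open>Y\<close> satisfies its characteristic polynomial; it is nonzero, hence
  injective by irreducibility, hence bijective by dimension.\<close>

subsection \<open>The modules \<open>O\<^sub>d(a, b, c)\<close>\<close>

lemma even_odd_cases:
  fixes i :: nat
  obtains (even) m where "i = 2 * m" | (odd) m where "i = 2 * m + 1"
  by (metis evenE oddE)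

definition OZ :: "nat \<Rightarrow> complex \<Rightarrow> complex \<Rightarrow> complex \<Rightarrow> (nat \<Rightarrow> complex) \<Rightarrow> nat \<Rightarrow> complex" where
  "OZ d a b c v = (\<lambda>i. OX d a (OY d a b c v) i + OY d a b c (OX d a v) i
                   - (2 * a * b - c * (of_nat d + 1)) * v i)"

lemma Omod_simps [simp]:
  "bcar (Omod d a b c) = {v. \<forall>i>d. v i = 0}"
  "actX (Omod d a b c) = OX d a"
  "actY (Omod d a b c) = OY d a b c"
  "actZ (Omod d a b c) = OZ d a b c"
  by (auto simp: Omod_def OZ_def fun_eq_iff)

lemma Ophi_0 [simp]: "Ophi d a b c 0 = 0"
  by (simp add: Ophi_def)

lemma Ophi_top: "even d \<Longrightarrow> Ophi d a b c (Suc d) = 0"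
  by (simp add: Ophi_def)

lemma OX_out: "d < i \<Longrightarrow> OX d a v i = 0"
  by (simp add: OX_def)

lemma OY_out: "d < i \<Longrightarrow> OY d a b c v i = 0"
  by (simp add: OY_def)

lemma OX_0: "OX d a v 0 = Otheta d a 0 * v 0"
  by (simp add: OX_def)

lemma OX_Suc: "Suc i \<le> d \<Longrightarrow> OX d a v (Suc i) = Otheta d a (Suc i) * v (Suc i) + v i"
  by (simp add: OX_def)

lemma OY_eq:
  assumes "even d" "i \<le> d"
  shows "OY d a b c v i = Otheta d b i * v i + Ophi d a b c (Suc i) * v (Suc i)"
  using assms Ophi_top[of d a b c] by (cases "i = d") (auto simp: OY_def)

lemma OX_lin: "OX d a (\<lambda>x. p * f x + q * g x) = (\<lambda>x. p * OX d a f x + q * OX d a g x)"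
  by (auto simp: OX_def fun_eq_iff algebra_simps)

lemma OY_lin: "OY d a b c (\<lambda>x. p * f x + q * g x) = (\<lambda>x. p * OY d a b c f x + q * OY d a b c g x)"
  by (auto simp: OY_def fun_eq_iff algebra_simps)

lemma OZ_lin: "OZ d a b c (\<lambda>x. p * f x + q * g x) = (\<lambda>x. p * OZ d a b c f x + q * OZ d a b c g x)"
  by (simp add: OZ_def OX_lin OY_lin fun_eq_iff algebra_simps)

lemma Otheta_even: "Otheta (2 * h) a (2 * m) = a - of_nat h + 2 * of_nat m"
  by (simp add: Otheta_def field_simps)

lemma Otheta_odd: "Otheta (2 * h) a (Suc (2 * m)) = of_nat h - a - 2 * of_nat m - 1"
  by (simp add: Otheta_def field_simps)

lemma Ophi_even:
  "Ophi (2 * h) a b c (2 * m) = of_nat m * (2 * of_nat h + 1 - 4 * of_nat m - 2 * a - 2 * b - 2 * c)"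
  by (simp add: Ophi_def field_simps)

lemma Ophi_odd:
  "Ophi (2 * h) a b c (Suc (2 * m)) =
     (of_nat m - of_nat h) * (2 * of_nat h - 1 - 4 * of_nat m - 2 * a - 2 * b + 2 * c)"
  by (simp add: Ophi_def field_simps)

text \<open>Writing \<open>d = 2 * h\<close> and an index as \<open>2 * m\<close> or
  \<open>2 * m + 1\<close> removes all signs and halves, so that identities between matrix entries
  become polynomial identities in \<open>h\<close> and \<open>m\<close>.\<close>

lemmas O_parity = Otheta_even Otheta_odd Ophi_even Ophi_odd
  Otheta_even[of _ _ "Suc m" for m, simplified] Otheta_odd[of _ _ "Suc m" for m, simplified]
  Ophi_even[of _ _ _ _ "Suc m" for m, simplified] Ophi_odd[of _ _ _ _ "Suc m" for m, simplified]
  Otheta_even[of _ _ "Suc (Suc m)" for m, simplified] Ophi_even[of _ _ _ _ "Suc (Suc m)" for m, simplified]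
  Otheta_even[of _ _ 0, simplified] Otheta_odd[of _ _ 0, simplified] Ophi_odd[of _ _ _ _ 0, simplified]

text \<open>Consecutive diagonal entries of \<open>X\<close>, and likewise of \<open>Y\<close>, add
  up to a sign. Hence off the diagonal, row \<open>i\<close> of \<open>XY + YX\<close> is
  \<open>(-1)^i\<close> times row \<open>i\<close> of \<open>X - Y\<close>; only the diagonal needs
  a correction, a scalar depending on the parity of \<open>i\<close>.\<close>

lemma OZ_eq:
  assumes "even d" "i \<le> d"
  shows "OZ d a b c v i = (if even i then OX d a v i - OY d a b c v i + (b - a + c + of_nat d / 2) * v i
           else OY d a b c v i - OX d a v i + (b - a - c - of_nat d / 2 - 1) * v i)"
proof -
  obtain h where h: "d = 2 * h" using assms(1) by blast
  have *: "OY d a b c (OX d a v) i = Otheta d b i * OX d a v i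
        + Ophi d a b c (Suc i) * (Otheta d a (Suc i) * v (Suc i) + v i)"
    using assms Ophi_top[of d a b c] by (cases "i = d") (auto simp: OY_def OX_def)
  show ?thesis
  proof (cases i)
    case 0
    then show ?thesis
      using assms(2) unfolding OZ_def * unfolding h
      by (simp add: OX_0 OY_eq O_parity, simp add: algebra_simps)
  next
    case (Suc m)
    then show ?thesis
      using assms(2) unfolding OZ_def * unfolding h
      by (cases m rule: even_odd_cases) (simp_all add: OX_Suc OY_eq O_parity, simp_all add: algebra_simps)
  qed
qed

lemma OZ_out: "d < i \<Longrightarrow> v i = 0 \<Longrightarrow> OZ d a b c v i = 0"
  by (simp add: OZ_def OX_out OY_out)

text \<open>The scalar is the one in the definition of \<open>Z\<close> with the parameters rotated.
  This relation and that definition are what the cyclic symmetry rests on.\<close>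

lemma OY_OZ_anticomm:
  assumes d: "even d" and v: "\<And>i. d < i \<Longrightarrow> v i = 0"
  shows "OY d a b c (OZ d a b c v) i + OZ d a b c (OY d a b c v) i
         = OX d a v i + (2 * b * c - a * (of_nat d + 1)) * v i"
proof (cases "i \<le> d")
  case False
  then show ?thesis using v by (simp add: OX_out OY_out OZ_out)
next
  case i: True
  obtain h where h: "d = 2 * h" using d by blast
  let ?\<theta> = "Otheta d a" and ?\<eta> = "Otheta d b" and ?\<phi> = "Ophi d a b c"
  let ?X = "OX d a v" and ?Y = "OY d a b c v" and ?p = "of_nat d / 2 :: complex"
  \<comment> \<open>The factor \<phi>_(i+1) covers the border \<open>i = d\<close> too: it vanishes
    there, while \<open>OX\<close> is cut off.\<close>
  have X: "?\<phi> (Suc i) * ?X (Suc i) = ?\<phi> (Suc i) * (?\<theta> (Suc i) * v (Suc i) + v i)"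
    using i Ophi_top[OF d, of a b c] by (cases "i = d") (auto simp: OX_def)
  have Zs: "?\<phi> (Suc i) * OZ d a b c v (Suc i) = ?\<phi> (Suc i) *
     (if odd i then ?X (Suc i) - ?Y (Suc i) + (b - a + c + ?p) * v (Suc i)
      else ?Y (Suc i) - ?X (Suc i) + (b - a - c - ?p - 1) * v (Suc i))"
    using i Ophi_top[OF d, of a b c] d by (cases "i = d") (simp_all add: OZ_eq)
  have YY: "OY d a b c ?Y i = ?\<eta> i * ?Y i + ?\<phi> (Suc i) * ?Y (Suc i)"
    using d i by (simp add: OY_eq)
  have XY: "OX d a ?Y i = ?\<theta> i * ?Y i + (if i = 0 then 0 else ?Y (i - 1))"
    using i by (cases i) (simp_all add: OX_0 OX_Suc)
  have YZ: "OY d a b c (OZ d a b c v) i = ?\<eta> i * OZ d a b c v i + ?\<phi> (Suc i) * OZ d a b c v (Suc i)"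
    using d i by (simp add: OY_eq)
  have eq: "OY d a b c (OZ d a b c v) i + OZ d a b c (OY d a b c v) i =
     (if even i then 1 else -1) * (?\<eta> i * ?X i - ?\<phi> (Suc i) * (?\<theta> (Suc i) * v (Suc i) + v i)
        + (?\<theta> i - 2 * ?\<eta> i) * ?Y i + (if i = 0 then 0 else ?Y (i - 1)))
     + (if even i then (b - a + c + ?p) * (?\<eta> i * v i + ?Y i) + (b - a - c - ?p - 1) * ?\<phi> (Suc i) * v (Suc i)
        else (b - a - c - ?p - 1) * (?\<eta> i * v i + ?Y i) + (b - a + c + ?p) * ?\<phi> (Suc i) * v (Suc i))"
    unfolding YZ Zs OZ_eq[OF d i] YY XY X[symmetric]
    by (simp add: algebra_simps)
  show ?thesis
  proof (cases i)
    case 0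
    then show ?thesis
      unfolding eq unfolding h by (simp add: OY_eq OX_0 O_parity, simp add: algebra_simps)
  next
    case (Suc m)
    then show ?thesis
      using i unfolding eq unfolding h
      by (cases m rule: even_odd_cases)
        (simp_all add: OY_eq OX_Suc O_parity, simp_all add: algebra_simps)
  qed
qed

subsection \<open>Irreducibility\<close>

lemma csubspace_add: "csubspace_of U \<Longrightarrow> f \<in> U \<Longrightarrow> g \<in> U \<Longrightarrow> (\<lambda>x. f x + g x) \<in> U"
  by (simp add: csubspace_of_def)

lemma csubspace_scale: "csubspace_of U \<Longrightarrow> f \<in> U \<Longrightarrow> (\<lambda>x. p * f x) \<in> U"
  by (simp add: csubspace_of_def)

lemma csubspace_lin:
  assumes "csubspace_of U" "f \<in> U" "g \<in> U"
  shows "(\<lambda>x. p * f x + q * g x) \<in> U"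
  using assms by (intro csubspace_add csubspace_scale)

lemma csubspace_sum:
  assumes "csubspace_of U" "finite I" "\<And>i. i \<in> I \<Longrightarrow> f i \<in> U"
  shows "(\<lambda>x. \<Sum>i\<in>I. p i * f i x) \<in> U"
  using assms(2,3)
proof (induction I rule: finite_induct)
  case empty
  then show ?case using assms(1) by (simp add: csubspace_of_def vzero_def)
next
  case (insert i I)
  have "(\<lambda>x. p i * f i x + 1 * (\<Sum>i\<in>I. p i * f i x)) \<in> U"
    by (rule csubspace_lin[OF assms(1)]) (use insert in auto)
  then show ?case using insert by simp
qed

definition unitv :: "nat \<Rightarrow> nat \<Rightarrow> complex" where
  "unitv j = (\<lambda>x. if x = j then 1 else 0)"

lemma unitv_expand:
  assumes "\<And>i. d < i \<Longrightarrow> v i = 0"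
  shows "v = (\<lambda>x. \<Sum>i\<le>d. v i * unitv i x)"
proof
  fix x
  have "(\<Sum>i\<le>d. v i * unitv i x) = (\<Sum>i\<le>d. if i = x then v i else 0)"
    by (intro sum.cong) (auto simp: unitv_def)
  then show "v x = (\<Sum>i\<le>d. v i * unitv i x)"
    using assms[of x] by (cases "x \<le> d") auto
qed

lemma OX_unitv:
  "j < d \<Longrightarrow> unitv (Suc j) = (\<lambda>x. 1 * OX d a (unitv j) x + (- Otheta d a j) * unitv j x)"
  by (auto simp: unitv_def OX_def fun_eq_iff)

text \<open>The subdiagonal entries of \<open>X\<close> are 1, so \<open>X\<close> produces each
  unit vector from the preceding one, up to a multiple of the latter.\<close>

lemma Omod_unitv0_generates:
  assumes "bi_submodule U (Omod d a b c)" "unitv 0 \<in> U"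
  shows "U = bcar (Omod d a b c)"
proof
  show "U \<subseteq> bcar (Omod d a b c)" using assms(1) by (simp add: bi_submodule_def)
  have sub: "csubspace_of U" and X: "\<And>v. v \<in> U \<Longrightarrow> OX d a v \<in> U"
    using assms(1) by (auto simp: bi_submodule_def)
  have u: "j \<le> d \<Longrightarrow> unitv j \<in> U" for j
  proof (induction j)
    case (Suc j)
    then show ?case using OX_unitv[of j d a] csubspace_lin[OF sub X[of "unitv j"], of "unitv j" 1 "- Otheta d a j"]
      by simp
  qed (simp add: assms)
  show "bcar (Omod d a b c) \<subseteq> U"
  proof
    fix v assume "v \<in> bcar (Omod d a b c)"
    then have "v = (\<lambda>x. \<Sum>i\<le>d. v i * unitv i x)" by (intro unitv_expand) auto
    moreover have "(\<lambda>x. \<Sum>i\<le>d. v i * unitv i x) \<in> U"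
      using u by (intro csubspace_sum[OF sub]) auto
    ultimately show "v \<in> U" by simp
  qed
qed

text \<open>The coefficients at \<open>m\<close> and \<open>s = m + 1\<close> of the condition that \<open>(Y - \<theta>*\<^bsub>s+1\<^esub>) X u\<close> is a multiple
  of \<open>u\<close>, for a \<open>Y\<close>-eigenvector \<open>u\<close> with leading index \<open>s\<close>.\<close>

lemma split_obstruction:
  fixes x :: complex
  assumes "(S - M) * x = F" "N = M + 2 * g" "2 * x2 = - g * fm * x" "g * g = 1"
    and "(S - N) * (ts + x) + fn = r" "(M - N) * (tm * x + x2) + F * (ts + x) = r * x"
  shows "x * ((S - M) * (2 * g * (ts - tm) + fm - fn) + 2 * g * F) = 0"
proof -
  \<comment> \<open>\<open>S\<close>, \<open>M\<close>, \<open>N\<close> are the diagonal entries of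
    \<open>Y\<close> at \<open>s\<close>, \<open>m\<close>, \<open>s + 1\<close>, and
    \<open>ts\<close>, \<open>tm\<close> those of \<open>X\<close> at \<open>s\<close>,
    \<open>m\<close>; \<open>F\<close>, \<open>fm\<close>, \<open>fn\<close> are \<phi>_s, \<phi>_m,
    \<phi>_(s+1), and \<open>x\<close>, \<open>x2\<close> the entries of \<open>u\<close> at
    \<open>m\<close>, \<open>m - 1\<close>; \<open>g\<close> is \<open>(-1)^m\<close>. Eliminating
    \<open>r\<close> leaves one equation, and multiplying it by \<open>S - M\<close> turns the
    remaining \<open>x\<close> in the bracket into \<open>F\<close>.\<close>
  have "x * (2 * g * (ts - tm) + (g * g) * fm - fn + 2 * g * x) =
      (M - N) * (tm * x + x2) + F * (ts + x) - x * ((S - N) * (ts + x) + fn)"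
    unfolding assms(2) assms(1)[symmetric] using assms(3) by algebra
  also have "\<dots> = 0" using assms(5,6) by simp
  finally have "(S - M) * (x * (2 * g * (ts - tm) + fm - fn + 2 * g * x)) = 0" using assms(4) by simp
  then show ?thesis unfolding assms(1)[symmetric] by algebra
qed

text \<open>The conditions \<open>odd\<close> and \<open>ev\<close> exclude the linear factors of
  the obstruction for a leading index \<open>s\<close> of either parity, and \<phi>_s \<noteq> 0
  makes the entry of \<open>u\<close> at \<open>s - 1\<close> nonzero. Only \<open>s = 0\<close>
  survives, and then \<open>unitv 0\<close> lies in the submodule.\<close>

lemma Omod_irreducible:
  assumes d: "even d"
    and phi: "\<And>s. 1 \<le> s \<Longrightarrow> s \<le> d \<Longrightarrow> Ophi d a b c s \<noteq> 0"
    and odd: "\<And>s. odd s \<Longrightarrow> s \<le> d \<Longrightarrow> of_nat s + 2 * b \<noteq> 0 \<and> 2 * of_nat s + 2 * (c - a + b) - of_nat d - 1 \<noteq> 0"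
    and ev: "\<And>s. even s \<Longrightarrow> 1 \<le> s \<Longrightarrow> s \<le> d \<Longrightarrow> of_nat s + 2 * b - of_nat d - 1 \<noteq> 0 \<and>
                2 * of_nat s + 2 * (b - a - c) - of_nat d - 1 \<noteq> 0"
  shows "bi_irreducible (Omod d a b c)"
  unfolding bi_irreducible_def
proof (intro conjI allI impI)
  have "unitv 0 \<in> bcar (Omod d a b c)" "unitv 0 \<noteq> vzero"
    by (auto simp: unitv_def vzero_def fun_eq_iff)
  then show "bcar (Omod d a b c) \<noteq> {vzero}" by blast
  fix U assume U: "bi_submodule U (Omod d a b c)"
  then have sub: "csubspace_of U" and Ud: "\<And>v i. v \<in> U \<Longrightarrow> d < i \<Longrightarrow> v i = 0"
    and X: "\<And>v. v \<in> U \<Longrightarrow> OX d a v \<in> U" and Y: "\<And>v. v \<in> U \<Longrightarrow> OY d a b c v \<in> U"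
    by (auto simp: bi_submodule_def)
  show "U = {vzero} \<or> U = bcar (Omod d a b c)"
  proof (cases "U = {vzero}")
    case False
    \<comment> \<open>A vector of \<open>U\<close> with minimal leading index is a \<open>Y\<close>-eigenvector, unique up to scaling.\<close>
    define P where "P s \<longleftrightarrow> (\<exists>u\<in>U. u s \<noteq> 0 \<and> (\<forall>j>s. u j = 0))" for s
    have P_top: "\<exists>s. P s \<and> v s \<noteq> 0 \<and> (\<forall>j>s. v j = 0)" if vU: "v \<in> U" and v0: "v \<noteq> vzero" for v
    proof -
      obtain j where "v j \<noteq> 0" using v0 by (auto simp: vzero_def fun_eq_iff)
      then have "\<exists>s. v s \<noteq> 0 \<and> (\<forall>j. v j \<noteq> 0 \<longrightarrow> j \<le> s)"
        using Ud[OF vU] by (intro ex_has_greatest_nat[where b = "Suc d" and k = j]) (auto simp: less_Suc_eq_le not_less[symmetric])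
      then show ?thesis using vU unfolding P_def by (meson not_le)
    qed
    have "vzero \<in> U" using sub by (simp add: csubspace_of_def)
    then obtain v where "v \<in> U" "v \<noteq> vzero" using False by blast
    then obtain s0 where "P s0" using P_top by blast
    define s where "s = (LEAST s. P s)"
    have "P s" unfolding s_def using \<open>P s0\<close> by (rule LeastI)
    then obtain u' where u': "u' \<in> U" "u' s \<noteq> 0" "\<And>j. s < j \<Longrightarrow> u' j = 0" by (auto simp: P_def)
    define u where "u = (\<lambda>x. (1 / u' s) * u' x + 0 * u' x)"
    have u: "u \<in> U" "u s = 1" "\<And>j. s < j \<Longrightarrow> u j = 0"
      using csubspace_lin[OF sub u'(1) u'(1), of "1 / u' s" 0] u' by (simp_all add: u_def)
    have sd: "s \<le> d" using Ud[OF u(1), of s] u(2) by (cases "s \<le> d") auto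
    have mult: "v = (\<lambda>x. v s * u x)" if "v \<in> U" "\<And>j. s < j \<Longrightarrow> v j = 0" for v
    proof -
      let ?w = "\<lambda>x. 1 * v x + (- v s) * u x"
      have "?w \<in> U" by (rule csubspace_lin[OF sub that(1) u(1)])
      moreover have False if w: "?w \<noteq> vzero" and wU: "?w \<in> U"
      proof -
        obtain t where t: "P t" "?w t \<noteq> 0" using P_top[OF wU w] by blast
        then have "t < s" using u \<open>\<And>j. s < j \<Longrightarrow> v j = 0\<close> by (cases t s rule: linorder_cases) auto
        then show False using t(1) not_less_Least[of t P] by (simp add: s_def)
      qed
      ultimately have "?w = vzero" by blast
      then have "v x = v s * u x" for x using fun_cong[of ?w vzero x] by (simp add: vzero_def)
      then show ?thesis by blast
    qed
    have Yu: "OY d a b c u = (\<lambda>x. Otheta d b s * u x)"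
    proof -
      have "OY d a b c u j = 0" if "s < j" for j
        using u(3) that by (auto simp: OY_def)
      then have "OY d a b c u = (\<lambda>x. OY d a b c u s * u x)" by (rule mult[OF Y[OF u(1)]])
      also have "OY d a b c u s = Otheta d b s" using u sd d by (simp add: OY_eq)
      finally show ?thesis .
    qed
    have "s = 0"
    proof (rule ccontr)
      assume "s \<noteq> 0"
      then obtain m where s: "s = Suc m" by (cases s) auto
      \<comment> \<open>\<open>X u\<close> has leading entry 1 at \<open>s + 1\<close>. Applying
        \<open>Y\<close> minus its diagonal entry there removes it, so \<open>?w\<close> lies in
        \<open>U\<close> with no entry above \<open>s\<close> and is a multiple of
        \<open>u\<close>.\<close>
      let ?w = "\<lambda>x. 1 * OY d a b c (OX d a u) x + (- Otheta d b (Suc s)) * OX d a u x"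
      have Xu: "OX d a u j = 0" if "Suc s < j" for j using u(3) that by (auto simp: OX_def)
      have "?w j = 0" if "s < j" for j
      proof (cases "j = Suc s")
        case True
        then show ?thesis using Xu[of "Suc (Suc s)"] u by (simp add: OY_def OX_def)
      next
        case False
        then show ?thesis using Xu that by (simp add: OY_def)
      qed
      then obtain r where "?w = (\<lambda>x. r * u x)"
        using mult[OF csubspace_lin[OF sub Y[OF X[OF u(1)]] X[OF u(1)], of 1 "- Otheta d b (Suc s)"]]
        by blast
      then have w: "OY d a b c (OX d a u) j - Otheta d b (Suc s) * OX d a u j = r * u j" for j
        by (simp add: fun_eq_iff)
      define x where "x = u m"
      \<comment> \<open>For \<open>m = 0\<close> the truncated index \<open>m - 1\<close> would
        repeat \<open>u 0\<close>; the value 0 agrees with \<phi>_0 = 0.\<close>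
      define x2 where "x2 = (if m = 0 then 0 else u (m - 1))"
      have Xm: "OX d a u m = Otheta d a m * x + x2"
        using sd s by (cases m) (auto simp: OX_def x_def x2_def)
      have Xs: "OX d a u s = Otheta d a s + x" using sd s u by (simp add: OX_Suc x_def)
      have Xss: "Ophi d a b c (Suc s) * OX d a u (Suc s) = Ophi d a b c (Suc s)"
        using sd u Ophi_top[OF d, of a b c] by (cases "s = d") (auto simp: OX_def)
      have e1: "(Otheta d b s - Otheta d b m) * x = Ophi d a b c s"
        using fun_cong[OF Yu, of m] d sd s u by (simp add: OY_eq x_def algebra_simps)
      have e2: "(Otheta d b s - Otheta d b (m - 1)) * x2 = Ophi d a b c m * x"
        using fun_cong[OF Yu, of "m - 1"] d sd s u
        by (cases m) (simp_all add: OY_eq x_def x2_def algebra_simps)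
      have e2s: "- 2 * (-1) ^ m * x2 = Ophi d a b c m * x"
        unfolding e2[symmetric] s
        by (cases m) (simp_all add: x2_def Otheta_def diff_divide_distrib[symmetric] algebra_simps)
      have e3: "(Otheta d b s - Otheta d b (Suc s)) * (Otheta d a s + x) + Ophi d a b c (Suc s) = r"
        using w[of s] u sd d by (simp add: OY_eq Xs Xss, simp add: algebra_simps)
      have e4: "(Otheta d b m - Otheta d b (Suc s)) * (Otheta d a m * x + x2)
          + Ophi d a b c s * (Otheta d a s + x) = r * x"
        using w[of m] u sd d s by (simp add: OY_eq Xm Xs[unfolded s] x_def[symmetric], simp add: algebra_simps)
      obtain h where h: "d = 2 * h" using d by blast
      have x: "x \<noteq> 0" using e1 phi[of s] s sd by auto
      show False
      proof (cases "odd s")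
        case True
        then obtain l where l: "m = 2 * l" using s by auto
        have e2': "2 * x2 = - Ophi d a b c m * x" using e2s l by (simp add: minus_equation_iff[of "2 * x2"] eq_commute[of "- _" "2 * x2"])
        have "x * ((Otheta d b s - Otheta d b m) * (2 * 1 * (Otheta d a s - Otheta d a m)
                + Ophi d a b c m - Ophi d a b c (Suc s)) + 2 * 1 * Ophi d a b c s) = 0"
          by (rule split_obstruction[OF e1 _ _ _ e3 e4])
            (use e2' in \<open>simp_all add: s l h O_parity\<close>)
        moreover have "(Otheta d b s - Otheta d b m) * (2 * 1 * (Otheta d a s - Otheta d a m)
                + Ophi d a b c m - Ophi d a b c (Suc s)) + 2 * 1 * Ophi d a b c s
             = - ((of_nat s + 2 * b) * (2 * of_nat s + 2 * (c - a + b) - of_nat d - 1))"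
          unfolding s l h by (simp add: O_parity, simp add: algebra_simps)
        ultimately have "x * ((of_nat s + 2 * b) * (2 * of_nat s + 2 * (c - a + b) - of_nat d - 1)) = 0"
          by (simp only: mult_minus_right neg_equal_0_iff_equal)
        then show False using odd[OF True sd] x by simp
      next
        case False
        then obtain l where l: "m = Suc (2 * l)" using s by (auto elim!: oddE)
        have e2': "2 * x2 = Ophi d a b c m * x" using e2s l by simp
        have "x * ((Otheta d b s - Otheta d b m) * (2 * (- 1) * (Otheta d a s - Otheta d a m)
                + Ophi d a b c m - Ophi d a b c (Suc s)) + 2 * (- 1) * Ophi d a b c s) = 0"
          by (rule split_obstruction[OF e1 _ _ _ e3 e4])
            (use e2' in \<open>simp_all add: s l h O_parity\<close>)
        moreover have "(Otheta d b s - Otheta d b m) * (2 * (- 1) * (Otheta d a s - Otheta d a m)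
                + Ophi d a b c m - Ophi d a b c (Suc s)) + 2 * (- 1) * Ophi d a b c s
             = (of_nat s + 2 * b - of_nat d - 1) * (2 * of_nat s + 2 * (b - a - c) - of_nat d - 1)"
          unfolding s l h by (simp add: O_parity, simp add: algebra_simps)
        ultimately have "x * ((of_nat s + 2 * b - of_nat d - 1) * (2 * of_nat s + 2 * (b - a - c) - of_nat d - 1)) = 0"
          by (simp only: mult_minus_right neg_equal_0_iff_equal)
        then show False using ev[of s] False s sd x by simp
      qed
    qed
    then have "u = unitv 0" using u by (auto simp: unitv_def fun_eq_iff)
    then show ?thesis using Omod_unitv0_generates[OF U] u(1) by simp
  qed simp
qed

section \<open>Submodules under twisting\<close>

lemma bi_submodule_twist:
  assumes U: "bi_submodule U (twist (p, q) cyc132 M)" and "p * p = 1" "q * q = 1"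
  shows "bi_submodule U M"
proof -
  have sub: "csubspace_of U" using U by (simp add: bi_submodule_def)
  have *: "\<And>v. v \<in> U \<Longrightarrow> (\<lambda>x. p * q * actZ M v x) \<in> U \<and> (\<lambda>x. p * actX M v x) \<in> U \<and> (\<lambda>x. q * actY M v x) \<in> U"
    using U by (simp add: bi_submodule_def twist_def twist_perm_def twist_sign_def gen_def cyc132_def)
  have scale: "f \<in> U" if "(\<lambda>x. c * f x) \<in> U" "c * c = 1" for c f
  proof -
    have "(\<lambda>x. c * (c * f x)) \<in> U" by (rule csubspace_scale[OF sub that(1)])
    then show ?thesis by (simp add: mult.assoc[symmetric] that(2))
  qed
  have "p * q * (p * q) = 1" using assms by algebra
  then show ?thesis
    using U * scale assms(2,3) unfolding bi_submodule_def
    by (auto simp: twist_def twist_perm_def twist_sign_def)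
qed

lemma bi_irreducible_twist:
  assumes "bi_irreducible M" "p * p = 1" "q * q = 1"
  shows "bi_irreducible (twist (p, q) cyc132 M)"
proof -
  have "bcar (twist (p, q) cyc132 M) = bcar M"
    by (simp add: twist_def twist_perm_def twist_sign_def)
  then show ?thesis using assms bi_submodule_twist[of _ p q M] by (simp add: bi_irreducible_def)
qed

subsection \<open>Cyclic symmetry of the modules \<open>O\<^sub>d(a, b, c)\<close>\<close>

text \<open>Dimension count on the functions supported in \<open>{0..d}\<close>. If \<open>y\<close>
  were outside the span of the images of the unit vectors, it would form with them
  \<open>d + 2\<close> independent vectors in a space spanned by \<open>d + 1\<close>.\<close>

lemma linear_inj_imp_surj:
  fixes \<Phi> :: "(nat \<Rightarrow> complex) \<Rightarrow> nat \<Rightarrow> complex"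
  assumes add: "\<And>f g. \<Phi> (\<lambda>x. f x + g x) = (\<lambda>x. \<Phi> f x + \<Phi> g x)"
    and scale: "\<And>c f. \<Phi> (\<lambda>x. c * f x) = (\<lambda>x. c * \<Phi> f x)"
    and into: "\<And>f i. d < i \<Longrightarrow> \<Phi> f i = 0"
    and inj: "\<And>f. (\<And>i. d < i \<Longrightarrow> f i = 0) \<Longrightarrow> \<Phi> f = vzero \<Longrightarrow> f = vzero"
    and y: "\<And>i. d < i \<Longrightarrow> y i = 0"
  shows "\<exists>f. (\<forall>i>d. f i = 0) \<and> \<Phi> f = y"
proof -
  define sc where "sc = (\<lambda>(c::complex) (f::nat \<Rightarrow> complex) x. c * f x)"
  interpret vs: vector_space sc
    by unfold_locales (auto simp: sc_def fun_eq_iff algebra_simps)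
  interpret vp: vector_space_pair sc sc ..
  have lin: "Vector_Spaces.linear sc sc \<Phi>"
  proof unfold_locales
    show "\<Phi> (f + g) = \<Phi> f + \<Phi> g" for f g using add[of f g] by (simp add: plus_fun_def)
    show "\<Phi> (sc c f) = sc c (\<Phi> f)" for c f using scale[of c f] by (simp add: sc_def)
  qed
  define E where "E = unitv ` {..d}"
  have injE: "inj_on unitv {..d}" by (auto simp: inj_on_def unitv_def fun_eq_iff split: if_splits)
  have fE: "finite E" and cE: "card E = Suc d" using injE by (auto simp: E_def card_image)
  have sum_fun: "(\<lambda>x. \<Sum>i\<in>I. f i x) = (\<Sum>i\<in>I. f i)" if "finite I" for I :: "nat set" and f :: "nat \<Rightarrow> nat \<Rightarrow> complex"
    using that by (induction I rule: finite_induct) (auto simp: fun_eq_iff zero_fun_def plus_fun_def)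
  have span: "vs.span E = {f. \<forall>i>d. f i = 0}" (is "_ = ?V")
  proof
    have "vs.subspace ?V" unfolding vs.subspace_def by (auto simp: sc_def)
    then show "vs.span E \<subseteq> ?V"
      by (intro vs.span_minimal) (auto simp: E_def unitv_def)
    show "?V \<subseteq> vs.span E"
    proof
      fix f assume "f \<in> ?V"
      then have "f = (\<lambda>x. \<Sum>i\<le>d. f i * unitv i x)" by (intro unitv_expand) auto
      then have "f = (\<Sum>i\<le>d. sc (f i) (unitv i))" by (simp add: sum_fun[symmetric] sc_def)
      also have "\<dots> \<in> vs.span E"
        by (intro vs.span_sum vs.span_scale vs.span_base) (auto simp: E_def)
      finally show "f \<in> vs.span E" .
    qed
  qed
  have vzero: "vzero = (0 :: nat \<Rightarrow> complex)" by (simp add: vzero_def fun_eq_iff)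
  have indE: "vs.independent E"
  proof (rule vs.independent_if_scalars_zero[OF fE])
    fix g e assume g: "(\<Sum>x\<in>E. sc (g x) x) = 0" and "e \<in> E"
    then obtain j where j: "j \<le> d" "e = unitv j" by (auto simp: E_def)
    have "(\<Sum>x\<in>E. sc (g x) x) = (\<Sum>i\<le>d. sc (g (unitv i)) (unitv i))"
      unfolding E_def by (rule sum.reindex_cong[OF injE]) auto
    then have "(\<Sum>i\<le>d. g (unitv i) * unitv i j) = 0"
      using fun_cong[OF g, of j] fun_cong[OF sum_fun[of "{..d}" "\<lambda>i. sc (g (unitv i)) (unitv i)"], of j]
      by (simp add: sc_def)
    moreover have "(\<Sum>i\<le>d. g (unitv i) * unitv i j) = (\<Sum>i\<le>d. if i = j then g (unitv i) else 0)"
      by (intro sum.cong) (auto simp: unitv_def)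
    ultimately show "g e = 0" using j by simp
  qed
  have injV: "inj_on \<Phi> (vs.span E)"
    by (subst vp.linear_inj_on_iff_eq_0[OF lin vs.subspace_span[of E]])
      (use inj in \<open>auto simp: vzero span\<close>)
  have indP: "vs.independent (\<Phi> ` E)"
    by (rule vp.linear_independent_injective_image[OF lin indE injV])
  have "inj_on \<Phi> E" using injV vs.span_superset[of E] by (rule inj_on_subset)
  then have cP: "card (\<Phi> ` E) = Suc d" by (simp add: card_image cE)
  have "y \<in> vs.span (\<Phi> ` E)"
  proof (rule ccontr)
    assume n: "y \<notin> vs.span (\<Phi> ` E)"
    then have i: "vs.independent (insert y (\<Phi> ` E))" by (rule vs.independent_insertI[OF _ indP])
    have "insert y (\<Phi> ` E) \<subseteq> vs.span E" using y into by (auto simp: span)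
    then have "card (insert y (\<Phi> ` E)) \<le> card E" using vs.independent_span_bound[OF fE i] by blast
    moreover have "y \<notin> \<Phi> ` E" using n vs.span_base by blast
    ultimately show False using cP cE fE by simp
  qed
  then have "y \<in> \<Phi> ` vs.span E" by (simp add: vp.linear_span_image[OF lin])
  then show ?thesis by (auto simp: span)
qed

section \<open>Split bases and the triple relation\<close>

lemma Otheta_add_Suc: "Otheta d a i + Otheta d a (Suc i) = - ((-1) ^ i)"
  by (simp add: Otheta_def field_simps)

text \<open>The coefficient of \<open>u (Suc i)\<close> when the triple relation on
  \<open>u i\<close> is solved for \<open>Q (u (Suc (Suc i)))\<close>: it yields the next
  superdiagonal entry.\<close>

lemma split_coeff1:
  assumes "even d"
  shows "(Otheta d b i + Otheta d b (Suc i)) * (Otheta d a i + Otheta d a (Suc i)) + Ophi d a b c i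
     + 2 * (Otheta d a i * Otheta d b i + Ophi d a b c (Suc i)) + 2 * Otheta d b (Suc i) * Otheta d a (Suc i)
     - 2 * (2 * a * b - c * (of_nat d + 1)) = - Ophi d a b c (Suc (Suc i))"
proof -
  obtain h where h: "d = 2 * h" using assms by blast
  show ?thesis unfolding h Otheta_add_Suc
    by (cases i rule: even_odd_cases) (simp_all add: O_parity, simp_all add: algebra_simps)
qed

text \<open>The coefficient of \<open>u i\<close> in the same expansion; its vanishing is what keeps
  \<open>Q\<close> bidiagonal.\<close>

lemma split_coeff0:
  assumes "even d"
  shows "2 * Otheta d a i * (Otheta d a i * Otheta d b i) + (-1) ^ i * Ophi d a b c i
     + 2 * Otheta d a i * (Otheta d a i * Otheta d b i + Ophi d a b c (Suc i) + Ophi d a b c i)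
     + (Otheta d a i + Otheta d a (Suc i)) * Ophi d a b c (Suc i) - Otheta d b i
     - (2 * a * c - b * (of_nat d + 1)) - 2 * (2 * a * b - c * (of_nat d + 1)) * Otheta d a i = 0"
proof -
  obtain h where h: "d = 2 * h" using assms by blast
  show ?thesis unfolding h Otheta_add_Suc
    by (cases i rule: even_odd_cases) (simp_all add: O_parity, simp_all add: algebra_simps)
qed

text \<open>Here \<open>um\<close>, \<open>u0\<close>, \<open>u1\<close>, \<open>u2\<close> are
  values of four consecutive basis vectors, \<open>t\<close>, \<open>e\<close>, \<open>f\<close>
  entries of the two matrices, and \<open>q2\<close> the unknown value of \<open>Q\<close> on the
  last vector. The coefficient of \<open>um\<close> is \<open>f * ((tm + t)^2 - 1)\<close>, which is
  0 because \<open>tm + t\<close> is a sign.\<close>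

lemma split_collect:
  fixes t :: complex
  assumes G: "G * G = 1" "tm + t = G"
    and r: "e * (t * (t * u0 + 1 * u1) + 1 * (t1 * u1 + 1 * u2)) + f * (tm * (tm * um + 1 * u0) + 1 * (t * u0 + 1 * u1))
      + 2 * (t * (e * (t * u0 + 1 * u1) + f * (tm * um + 1 * u0)) + 1 * (e1 * (t1 * u1 + 1 * u2) + f1 * (t * u0 + 1 * u1)))
      + (t * (t * (e * u0 + f * um) + 1 * (e1 * u1 + f1 * u0)) + 1 * (t1 * (e1 * u1 + f1 * u0) + 1 * q2))
      = e * u0 + f * um + k3 * u0 + 2 * k1 * (t * u0 + 1 * u1)"
  shows "q2 + (e + 2 * e1) * u2 + ((e + e1) * (t + t1) + f + 2 * (t * e + f1) + 2 * e1 * t1 - 2 * k1) * u1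
      + (2 * t * (t * e) + G * f + 2 * t * (t * e + f1 + f) + (t + t1) * f1 - e - k3 - 2 * k1 * t) * u0 = 0"
    (is "?l = 0")
proof -
  have tm: "tm = G - t" using G(2) by (simp add: algebra_simps)
  have "?l = (e * (t * (t * u0 + 1 * u1) + 1 * (t1 * u1 + 1 * u2)) + f * (tm * (tm * um + 1 * u0) + 1 * (t * u0 + 1 * u1))
      + 2 * (t * (e * (t * u0 + 1 * u1) + f * (tm * um + 1 * u0)) + 1 * (e1 * (t1 * u1 + 1 * u2) + f1 * (t * u0 + 1 * u1)))
      + (t * (t * (e * u0 + f * um) + 1 * (e1 * u1 + f1 * u0)) + 1 * (t1 * (e1 * u1 + f1 * u0) + 1 * q2)))
      - (e * u0 + f * um + k3 * u0 + 2 * k1 * (t * u0 + 1 * u1)) - f * um * (G * G - 1)"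
    unfolding tm by (simp add: algebra_simps)
  then show ?thesis unfolding r G(1) by simp
qed

text \<open>The relation \<open>{P, {P, Q}} = \<dots>\<close> determines \<open>Q u\<^bsub>i+2\<^esub>\<close> from \<open>Q u\<^bsub>i\<^esub>\<close> and \<open>Q u\<^bsub>i+1\<^esub>\<close>, so \<open>Q\<close> is upper
  bidiagonal as soon as it is so on the first two vectors.\<close>

lemma split_basis_recursion:
  fixes P Q :: "('x \<Rightarrow> complex) \<Rightarrow> 'x \<Rightarrow> complex" and u :: "nat \<Rightarrow> 'x \<Rightarrow> complex"
  assumes d: "even d"
    and linP: "\<And>p q f g. P (\<lambda>x. p * f x + q * g x) = (\<lambda>x. p * P f x + q * P g x)"
    and linQ: "\<And>p q f g. Q (\<lambda>x. p * f x + q * g x) = (\<lambda>x. p * Q f x + q * Q g x)"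
    and rel: "\<And>i x. P (P (Q (u i))) x + 2 * P (Q (P (u i))) x + Q (P (P (u i))) x
       = Q (u i) x + (2 * a * c - b * (of_nat d + 1)) * u i x
         + 2 * (2 * a * b - c * (of_nat d + 1)) * P (u i) x"
    and u: "\<And>i. u (Suc i) = (\<lambda>x. P (u i) x - Otheta d a i * u i x)"
    and Q0: "Q (u 0) = (\<lambda>x. Otheta d b 0 * u 0 x)"
    and Q1: "Q (u 1) = (\<lambda>x. Otheta d b 1 * u 1 x + Ophi d a b c 1 * u 0 x)"
  shows "Q (u i) = (\<lambda>x. Otheta d b i * u i x + Ophi d a b c i * u (i - 1) x)"
proof -
  let ?\<theta> = "Otheta d a" and ?\<eta> = "Otheta d b" and ?\<phi> = "Ophi d a b c"
  have Pu: "P (u i) = (\<lambda>x. ?\<theta> i * u i x + 1 * u (Suc i) x)" for i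
    by (simp add: u fun_eq_iff)
  define S where "S i \<longleftrightarrow> Q (u i) = (\<lambda>x. ?\<eta> i * u i x + ?\<phi> i * u (i - 1) x)" for i
  have step: "S (Suc (Suc i))" if S0: "S i" and S1: "S (Suc i)" for i
  proof -
    have q0: "Q (u i) = (\<lambda>x. ?\<eta> i * u i x + ?\<phi> i * u (i - 1) x)" using S0 by (simp add: S_def)
    have q1: "Q (u (Suc i)) = (\<lambda>x. ?\<eta> (Suc i) * u (Suc i) x + ?\<phi> (Suc i) * u i x)"
      using S1 by (simp add: S_def)
    have "Q (u (Suc (Suc i))) x = ?\<eta> (Suc (Suc i)) * u (Suc (Suc i)) x + ?\<phi> (Suc (Suc i)) * u (Suc i) x" for x
    proof -
      have "Q (u (Suc (Suc i))) x + (?\<eta> i + 2 * ?\<eta> (Suc i)) * u (Suc (Suc i)) x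
          + ((?\<eta> i + ?\<eta> (Suc i)) * (?\<theta> i + ?\<theta> (Suc i)) + ?\<phi> i
             + 2 * (?\<theta> i * ?\<eta> i + ?\<phi> (Suc i)) + 2 * ?\<eta> (Suc i) * ?\<theta> (Suc i)
             - 2 * (2 * a * b - c * (of_nat d + 1))) * u (Suc i) x
          + (2 * ?\<theta> i * (?\<theta> i * ?\<eta> i) + (-1) ^ i * ?\<phi> i
             + 2 * ?\<theta> i * (?\<theta> i * ?\<eta> i + ?\<phi> (Suc i) + ?\<phi> i)
             + (?\<theta> i + ?\<theta> (Suc i)) * ?\<phi> (Suc i) - ?\<eta> i
             - (2 * a * c - b * (of_nat d + 1)) - 2 * (2 * a * b - c * (of_nat d + 1)) * ?\<theta> i) * u i x = 0"
      proof (cases i)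
        case 0
        have q: "Q (u 0) = (\<lambda>x. ?\<eta> 0 * u 0 x + 0 * u 0 x)" using q0 by (simp add: 0)
        have "?\<phi> 0 = 0" by simp
        \<comment> \<open>No vector precedes \<open>u 0\<close>: \<open>um\<close> is taken to be 0,
          and \<open>tm\<close> is chosen to make \<open>tm + t\<close> equal to the required sign
          1.\<close>
        show ?thesis unfolding 0 \<open>?\<phi> 0 = 0\<close>
          by (rule split_collect[where tm = "1 - ?\<theta> 0" and um = 0])
            (use rel[of 0 x, unfolded q Pu linP linQ q1[unfolded 0]] in simp_all)
      next
        case (Suc m)
        have q: "Q (u (Suc m)) = (\<lambda>x. ?\<eta> (Suc m) * u (Suc m) x + ?\<phi> (Suc m) * u m x)"
          using q0 by (simp add: Suc)
        show ?thesis unfolding Suc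
          by (rule split_collect[OF _ _ rel[of "Suc m" x, unfolded q Pu linP linQ q1[unfolded Suc]]])
            (simp_all add: Otheta_add_Suc)
      qed
      moreover have "?\<eta> i + 2 * ?\<eta> (Suc i) = - ?\<eta> (Suc (Suc i))"
      proof -
        have "(?\<eta> i + ?\<eta> (Suc i)) + (?\<eta> (Suc i) + ?\<eta> (Suc (Suc i))) = 0"
          by (simp add: Otheta_add_Suc)
        then show ?thesis by (simp add: eq_neg_iff_add_eq_0 algebra_simps)
      qed
      ultimately show ?thesis
        unfolding split_coeff1[OF d] split_coeff0[OF d] by (simp add: algebra_simps)
    qed
    then show ?thesis by (simp add: S_def fun_eq_iff)
  qed
  have "S i \<and> S (Suc i)" for i
    by (induction i) (use step Q0 Q1 in \<open>auto simp: S_def\<close>)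
  then show ?thesis by (simp add: S_def)
qed

text \<open>Cayley-Hamilton for an upper triangular matrix: on a vector supported in
  \<open>{0..m}\<close> the factor for \<open>m\<close> clears the last entry. Reversing the list
  lets the largest index act first.\<close>

lemma OY_triangular_annihilates:
  assumes d: "even d" and m: "m \<le> Suc d" and f: "\<And>i. m \<le> i \<Longrightarrow> f i = 0" and s: "s * s = 1"
  shows "fold (\<lambda>i f x. s * OY d a b c f x - s * Otheta d b i * f x) (rev [0..<m]) f = vzero"
  using m f
proof (induction m arbitrary: f)
  case 0
  then show ?case by (simp add: vzero_def fun_eq_iff)
next
  case (Suc m)
  have "s * OY d a b c f i - s * Otheta d b m * f i = 0" if "m \<le> i" for i
  proof (cases "i \<le> d")
    case True
    then show ?thesis using Suc.prems(2)[of "Suc i"] Suc.prems(2)[of i] d that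
      by (cases "i = m") (simp_all add: OY_eq)
  next
    case False
    then show ?thesis using Suc.prems(2)[of i] Suc.prems(1) by (simp add: OY_out)
  qed
  then show ?case using Suc.prems(1) Suc.IH[of "\<lambda>x. s * OY d a b c f x - s * Otheta d b m * f x"] by simp
qed

lemma fold_step_commute:
  fixes P :: "(nat \<Rightarrow> complex) \<Rightarrow> nat \<Rightarrow> complex"
  assumes linP: "\<And>p q f g. P (\<lambda>x. p * f x + q * g x) = (\<lambda>x. p * P f x + q * P g x)"
  shows "(\<lambda>f x. P f x - s * f x) \<circ> (\<lambda>f x. P f x - t * f x)
       = (\<lambda>f x. P f x - t * f x) \<circ> (\<lambda>f x. P f x - s * f x)"
proof -
  have "P (\<lambda>x. P f x - t * f x) = (\<lambda>x. P (P f) x - t * P f x)" for f t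
    using linP[of 1 "P f" "- t" f] by simp
  then show ?thesis by (auto simp: fun_eq_iff algebra_simps)
qed

lemma Otheta_reverse: "i \<le> d \<Longrightarrow> even d \<Longrightarrow> Otheta d (- b) i = - Otheta d b (d - i)"
  by (cases "even i") (auto simp: Otheta_def of_nat_diff field_simps)

text \<open>This makes a split basis built with \<open>s * Y\<close> stop after \<open>d + 1\<close>
  vectors. For \<open>s = 1\<close> the commuting factors are reordered; for \<open>s = -1\<close>,
  negating the parameter negates and reverses the diagonal, so the factors already come in
  descending order.\<close>

lemma OY_split_annihilates:
  assumes d: "even d" and f: "\<And>i. d < i \<Longrightarrow> f i = 0" and s: "s = 1 \<or> s = -1"
  shows "fold (\<lambda>i f x. s * OY d a b c f x - Otheta d (s * b) i * f x) [0..<Suc d] f = vzero"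
proof -
  define st where "st i = (\<lambda>f x. s * OY d a b c f x - s * Otheta d b i * f x)" for i
  have ann: "fold st (rev [0..<Suc d]) f = vzero"
    unfolding st_def by (rule OY_triangular_annihilates[OF d]) (use f s in auto)
  from s show ?thesis
  proof
    assume s1: "s = 1"
    have "fold st (rev [0..<Suc d]) = fold st [0..<Suc d]"
    proof (rule fold_rev)
      show "st y \<circ> st x = st x \<circ> st y" for x y
        unfolding st_def
        by (rule fold_step_commute) (simp add: OY_lin fun_eq_iff algebra_simps)
    qed
    moreover have "(\<lambda>i f x. s * OY d a b c f x - Otheta d (s * b) i * f x) = st"
      by (intro ext) (simp add: st_def s1)
    ultimately show ?thesis using ann by simp
  next
    assume s1: "s = -1"
    have "fold (\<lambda>i f x. s * OY d a b c f x - Otheta d (s * b) i * f x) [0..<Suc d] f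
        = fold (st \<circ> (\<lambda>i. d - i)) [0..<Suc d] f"
      by (rule fold_cong) (auto simp: st_def s1 Otheta_reverse d)
    also have "\<dots> = fold st (map (\<lambda>i. d - i) [0..<Suc d]) f" by (simp only: fold_map)
    also have "map (\<lambda>i. d - i) [0..<Suc d] = rev [0..<Suc d]"
      by (rule nth_equalityI) (auto simp: rev_nth nth_append simp del: upt_Suc)
    finally show ?thesis using ann by simp
  qed
qed

text \<open>For \<open>s = 1\<close> both \<open>X\<close> and \<open>Y\<close> act on \<open>w\<close> coordinatewise, because \<open>\<phi>\<^bsub>j\<^esub> = q\<^bsub>j\<^esub> r\<^bsub>j\<^esub>\<close> and
  \<open>w\<^bsub>j-1\<^esub> = r\<^bsub>j\<^esub> w\<^bsub>j\<^esub>\<close>; for \<open>s = -1\<close> the vector \<open>w\<close> lives on the even indices. Both are normalised by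
  \<open>w\<^bsub>d\<^esub> = 1\<close>, which avoids dividing by \<open>\<phi>\<^bsub>j\<^esub>\<close>.\<close>

lemma exists_top_vector:
  assumes d: "even d" and s: "s = 1 \<or> s = -1"
  shows "\<exists>w. (\<forall>i>d. w i = 0) \<and> w \<noteq> vzero
     \<and> (\<forall>i. s * OZ d a b c w i = Otheta d (s * c) 0 * w i)
     \<and> (\<forall>i. OX d a w i + s * OY d a b c w i = (a + s * b) * w i)"
  using s
proof
  assume s1: "s = 1"
  \<comment> \<open>The factors of \<phi>_j are distributed so that \<open>r 0 = 0\<close>,
    \<open>q (Suc d) = 0\<close>, and the eigenvalues of \<open>X\<close> at \<open>j\<close> and of
    \<open>Y\<close> at \<open>j\<close> always add up to \<open>a + b\<close>.\<close>
  define r where "r j = (if even j then - of_nat j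
      else - (of_nat d + 1 - 2 * of_nat j - 2 * a - 2 * b + 2 * c) / 2)" for j :: nat
  define q where "q j = (if even j then - (of_nat d + 1 - 2 * of_nat j - 2 * a - 2 * b - 2 * c) / 2
      else of_nat d + 1 - of_nat j)" for j :: nat
  have rq: "Ophi d a b c j = q j * r j" for j
    by (simp add: Ophi_def r_def q_def field_simps)
  define w where "w j = (if j \<le> d then \<Prod>l\<in>{j<..d}. r l else 0)" for j
  have w: "r (Suc j) * w (Suc j) = w j" if "j < d" for j
  proof -
    have "{j<..d} = insert (Suc j) {Suc j<..d}" using that by auto
    then show ?thesis using that by (simp add: w_def)
  qed
  have X: "OX d a w j = (Otheta d a j + r j) * w j" if "j \<le> d" for j
  proof (cases j)
    case (Suc i)
    then show ?thesis using that w[of i] by (simp add: OX_Suc algebra_simps)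
  qed (simp add: OX_0 r_def)
  have Y: "OY d a b c w j = (Otheta d b j + q (Suc j)) * w j" if "j \<le> d" for j
  proof (cases "j = d")
    case True
    then show ?thesis using d by (simp add: OY_def q_def)
  next
    case False
    then show ?thesis using that d w[of j] by (simp add: OY_eq rq algebra_simps)
  qed
  have "OX d a w i + OY d a b c w i = (a + b) * w i" for i
  proof (cases "i \<le> d")
    case True
    have "Otheta d a i + r i + (Otheta d b i + q (Suc i)) = a + b"
      by (cases "even i") (simp_all add: Otheta_def r_def q_def field_simps)
    then show ?thesis unfolding X[OF True] Y[OF True] by (metis distrib_right)
  qed (simp add: OX_out OY_out w_def)
  moreover have "OZ d a b c w i = Otheta d c 0 * w i" for i
  proof (cases "i \<le> d")
    case True
    have "OZ d a b c w i = (if even i then (Otheta d a i + r i) - (Otheta d b i + q (Suc i)) + (b - a + c + of_nat d / 2)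
           else (Otheta d b i + q (Suc i)) - (Otheta d a i + r i) + (b - a - c - of_nat d / 2 - 1)) * w i"
      unfolding OZ_eq[OF d True] X[OF True] Y[OF True] by (simp add: algebra_simps)
    also have "(if even i then (Otheta d a i + r i) - (Otheta d b i + q (Suc i)) + (b - a + c + of_nat d / 2)
           else (Otheta d b i + q (Suc i)) - (Otheta d a i + r i) + (b - a - c - of_nat d / 2 - 1)) = Otheta d c 0"
      by (cases "even i") (simp_all add: Otheta_def r_def q_def field_simps)
    finally show ?thesis .
  qed (simp add: OZ_out w_def)
  moreover have "w \<noteq> vzero" by (auto simp: fun_eq_iff vzero_def w_def intro!: exI[of _ d])
  ultimately show ?thesis by (intro exI[of _ w]) (auto simp: s1 w_def)
next
  assume s1: "s = -1"
  \<comment> \<open>On odd rows \<open>X w\<close> and \<open>Y w\<close> both equal the preceding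
    entry of \<open>w\<close> and cancel in \<open>X - Y\<close>; on even rows the diagonal entries
    differ by the constant \<open>a - b\<close>.\<close>
  define w where "w j = (if even j \<and> j \<le> d then \<Prod>l\<in>{l. even l \<and> j < l \<and> l \<le> d}. Ophi d a b c l else 0)" for j
  have w: "Ophi d a b c (Suc (Suc j)) * w (Suc (Suc j)) = w j" if "j < d" "even j" for j
  proof -
    have "Suc (Suc j) \<le> d" using that d by (metis Suc_leI even_Suc le_antisym not_less_eq_eq)
    moreover have "{l. even l \<and> j < l \<and> l \<le> d} = insert (Suc (Suc j)) {l. even l \<and> Suc (Suc j) < l \<and> l \<le> d}"
      using calculation that by (auto simp: less_Suc_eq) (metis Suc_lessI even_Suc less_Suc_eq)
    ultimately show ?thesis using that by (simp add: w_def)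
  qed
  have X: "OX d a w j = (if even j then Otheta d a j * w j else w (j - 1))" if "j \<le> d" for j
    using that by (cases j) (auto simp: OX_0 OX_Suc w_def)
  have Y: "OY d a b c w j = (if even j then Otheta d b j * w j else w (j - 1))" if "j \<le> d" for j
  proof (cases "even j")
    case True
    then show ?thesis using that d by (simp add: OY_eq w_def)
  next
    case False
    then obtain i where "j = Suc i" "even i" by (cases j) auto
    then show ?thesis using that d w[of i] by (simp add: OY_eq w_def[of "Suc i"])
  qed
  have wodd: "odd j \<Longrightarrow> w j = 0" for j by (simp add: w_def)
  have "OX d a w i - OY d a b c w i = (a - b) * w i" for i
    by (cases "i \<le> d") (auto simp: X Y OX_out OY_out w_def Otheta_def field_simps)
  moreover have "- OZ d a b c w i = Otheta d (- c) 0 * w i" for i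
  proof (cases "i \<le> d")
    case True
    then show ?thesis
      by (cases "even i") (simp_all add: OZ_eq[OF d True] X Y wodd Otheta_def field_simps)
  qed (simp add: OZ_out w_def)
  moreover have "w \<noteq> vzero" using d by (auto simp: fun_eq_iff vzero_def w_def intro!: exI[of _ d])
  ultimately show ?thesis by (intro exI[of _ w]) (auto simp: s1 w_def)
qed

section \<open>The homomorphism out of the twisted module\<close>

lemma twist_simps [simp]:
  "bcar (twist (p, q) cyc132 M) = bcar M"
  "actX (twist (p, q) cyc132 M) v = (\<lambda>x. p * q * actZ M v x)"
  "actY (twist (p, q) cyc132 M) v = (\<lambda>x. p * actX M v x)"
  "actZ (twist (p, q) cyc132 M) v = (\<lambda>x. q * actY M v x)"
  by (auto simp: twist_def twist_perm_def twist_sign_def gen_def cyc132_def)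

text \<open>On the target, \<open>P = s * Y\<close>, \<open>Q = s * Z\<close> and \<open>X\<close>
  take over the roles of \<open>X\<close>, \<open>Y\<close>, \<open>Z\<close> of the module with
  rotated parameters. Starting from the common eigenvector \<open>w\<close>, the products of
  \<open>P\<close> minus its diagonal entries give a split basis for them.\<close>

lemma twist_cyc_isomorphic:
  assumes d: "even d" and s: "s = 1 \<or> s = -1"
    and irr: "bi_irreducible (Omod d (s * b) (s * c) a)"
  shows "bi_isomorphic (twist (s, s) cyc132 (Omod d (s * b) (s * c) a)) (Omod d a b c)"
proof -
  have ss: "s * s = 1" using s by auto
  obtain w where w: "(\<forall>i>d. w i = 0) \<and> w \<noteq> vzero
     \<and> (\<forall>i. s * OZ d a b c w i = Otheta d (s * c) 0 * w i)
     \<and> (\<forall>i. OX d a w i + s * OY d a b c w i = (a + s * b) * w i)"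
    using exists_top_vector[OF d s] by (rule exE)
  then have w0: "\<And>i. d < i \<Longrightarrow> w i = 0" and wn: "w \<noteq> vzero"
    and wZ: "\<And>i. s * OZ d a b c w i = Otheta d (s * c) 0 * w i"
    and wXY: "\<And>i. OX d a w i + s * OY d a b c w i = (a + s * b) * w i"
    by simp_all
  define P where "P f = (\<lambda>x. s * OY d a b c f x)" for f
  define Q where "Q f = (\<lambda>x. s * OZ d a b c f x)" for f
  let ?\<theta> = "Otheta d (s * b)" and ?\<eta> = "Otheta d (s * c)" and ?\<phi> = "Ophi d (s * b) (s * c) a"
  let ?k = "2 * (s * b) * (s * c) - a * (of_nat d + 1)"
  have linP: "P (\<lambda>x. p * f x + q * g x) = (\<lambda>x. p * P f x + q * P g x)" for p q f g
    by (simp add: P_def OY_lin fun_eq_iff algebra_simps)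
  have linQ: "Q (\<lambda>x. p * f x + q * g x) = (\<lambda>x. p * Q f x + q * Q g x)" for p q f g
    by (simp add: Q_def OZ_lin fun_eq_iff algebra_simps)
  have linR: "OX d a (\<lambda>x. p * f x + q * g x) = (\<lambda>x. p * OX d a f x + q * OX d a g x)" for p q f g
    by (rule OX_lin)
  have Yscale: "OY d a b c (\<lambda>x. p * f x) = (\<lambda>x. p * OY d a b c f x)" for p f
    using OY_lin[of d a b c p f 0 f] by simp
  have Zscale: "OZ d a b c (\<lambda>x. p * f x) = (\<lambda>x. p * OZ d a b c f x)" for p f
    using OZ_lin[of d a b c p f 0 f] by simp
  have Xscale: "OX d a (\<lambda>x. p * f x) = (\<lambda>x. p * OX d a f x)" for p f
    using OX_lin[of d a p f 0 f] by simp
  have PQ: "P (Q f) x + Q (P f) x = OX d a f x + ?k * f x" if "\<And>i. d < i \<Longrightarrow> f i = 0" for f x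
  proof -
    have "P (Q f) x + Q (P f) x = (s * s) * (OY d a b c (OZ d a b c f) x + OZ d a b c (OY d a b c f) x)"
      by (simp add: P_def Q_def Yscale Zscale algebra_simps)
    also have "\<dots> = OX d a f x + (2 * b * c - a * (of_nat d + 1)) * f x"
      using OY_OZ_anticomm[OF d that] by (simp add: ss)
    also have "2 * b * c - a * (of_nat d + 1) = ?k"
      using ss by algebra
    finally show ?thesis .
  qed
  have PR: "P (OX d a f) x + OX d a (P f) x = Q f x + (2 * (s * b) * a - s * c * (of_nat d + 1)) * f x" for f x
    by (simp add: P_def Q_def Xscale OZ_def algebra_simps)
  have Psupp: "d < i \<Longrightarrow> P f i = 0" for f i by (simp add: P_def OY_out)
  \<comment> \<open>With \<open>R\<close> the action of \<open>X\<close>: {P, Q} is \<open>R\<close>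
    plus a scalar and {P, R} is \<open>Q\<close> plus a scalar, which together evaluate {P, {P,
    Q}}.\<close>
  have rel: "P (P (Q f)) x + 2 * P (Q (P f)) x + Q (P (P f)) x
       = Q f x + (2 * (s * b) * a - s * c * (of_nat d + 1)) * f x + 2 * ?k * P f x"
    if f: "\<And>i. d < i \<Longrightarrow> f i = 0" for f x
  proof -
    have "P (Q f) = (\<lambda>x. 1 * OX d a f x + 1 * (?k * f x + (-1) * Q (P f) x))"
    proof
      fix x
      show "P (Q f) x = 1 * OX d a f x + 1 * (?k * f x + (-1) * Q (P f) x)"
        using PQ[of f x, OF f] by (simp add: eq_diff_eq[symmetric])
    qed
    then have h1: "P (P (Q f)) x = P (OX d a f) x + ?k * P f x - P (Q (P f)) x"
      by (simp only: linP) simp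
    have h2: "P (Q (P f)) x + Q (P (P f)) x = OX d a (P f) x + ?k * P f x"
      by (rule PQ[of "P f" x]) (rule Psupp)
    have "P (P (Q f)) x + 2 * P (Q (P f)) x + Q (P (P f)) x
        = (P (P (Q f)) x + P (Q (P f)) x) + (P (Q (P f)) x + Q (P (P f)) x)" by simp
    also have "\<dots> = (P (OX d a f) x + OX d a (P f) x) + 2 * ?k * P f x"
      unfolding h2 h1 by (simp only: mult_2 distrib_right) simp
    finally show ?thesis unfolding PR .
  qed
  define u where "u i = fold (\<lambda>i f x. P f x - ?\<theta> i * f x) [0..<i] w" for i
  have u0: "u 0 = w" by (simp add: u_def)
  have uS: "u (Suc i) = (\<lambda>x. P (u i) x - ?\<theta> i * u i x)" for i
    by (simp add: u_def)
  have usupp: "d < j \<Longrightarrow> u i j = 0" for i j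
    by (induction i) (auto simp: u0 uS w0 Psupp)
  have uend: "u (Suc d) = vzero"
    unfolding u_def P_def by (rule OY_split_annihilates[OF d w0 s])
  have Pu: "P (u i) = (\<lambda>x. ?\<theta> i * u i x + u (Suc i) x)" for i
    by (simp add: uS fun_eq_iff)
  have Q0: "Q (u 0) = (\<lambda>x. ?\<eta> 0 * u 0 x)"
    using wZ by (simp add: u0 Q_def fun_eq_iff)
  \<comment> \<open>Here the eigenvector property of \<open>X + s * Y\<close> enters: it expresses
    \<open>X w\<close> by \<open>w\<close> and \<open>P w\<close>, so \<open>Q (P w)\<close> stays
    in their span.\<close>
  have Q1: "Q (u 1) = (\<lambda>x. ?\<eta> 1 * u 1 x + ?\<phi> 1 * u 0 x)"
  proof
    fix x
    have "P (Q w) = (\<lambda>x. ?\<eta> 0 * P w x)"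
      using linP[of "?\<eta> 0" w 0 w] Q0 by (simp add: u0)
    moreover have "P (Q w) x + Q (P w) x = OX d a w x + ?k * w x" by (rule PQ[of w x, OF w0])
    moreover have "OX d a w x = (a + s * b) * w x - P w x" using wXY[of x] by (simp add: P_def algebra_simps)
    ultimately have QP: "Q (P w) x = (a + s * b + ?k) * w x - (1 + ?\<eta> 0) * P w x"
      by (simp add: algebra_simps)
    have "u 1 = (\<lambda>x. 1 * P w x + (- ?\<theta> 0) * w x)" by (simp add: uS[of 0, simplified] u0)
    then have "Q (u 1) x = 1 * Q (P w) x + (- ?\<theta> 0) * Q w x" by (simp only: linQ)
    also have "\<dots> = (a + s * b + ?k - ?\<theta> 0 * ?\<eta> 0 - (1 + ?\<eta> 0) * ?\<theta> 0) * w x - (1 + ?\<eta> 0) * u 1 x"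
      using fun_cong[OF Q0, of x] by (simp add: QP uS[of 0, simplified] u0 algebra_simps)
    finally have q: "Q (u 1) x = (a + s * b + ?k - ?\<theta> 0 * ?\<eta> 0 - (1 + ?\<eta> 0) * ?\<theta> 0) * w x
        - (1 + ?\<eta> 0) * u 1 x" .
    have e1: "1 + ?\<eta> 0 = - ?\<eta> 1" by (simp add: Otheta_def field_simps)
    have k1: "a + s * b + ?k - ?\<theta> 0 * ?\<eta> 0 - (1 + ?\<eta> 0) * ?\<theta> 0 = ?\<phi> 1"
      by (simp add: Otheta_def Ophi_def field_simps)
    show "Q (u 1) x = ?\<eta> 1 * u 1 x + ?\<phi> 1 * u 0 x"
      unfolding q[unfolded k1] e1 by (simp add: u0)
  qed
  have Qu: "Q (u i) = (\<lambda>x. ?\<eta> i * u i x + ?\<phi> i * u (i - 1) x)" for i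
    by (rule split_basis_recursion[OF d linP linQ rel[OF usupp] uS Q0 Q1])
  define \<Psi> where "\<Psi> v = (\<lambda>x. \<Sum>i\<le>d. v i * u i x)" for v
  have P_sum: "P (\<lambda>x. \<Sum>i\<in>I. v i * g i x) = (\<lambda>x. \<Sum>i\<in>I. v i * P (g i) x)" if "finite I" for I :: "nat set" and v g
    using that
  proof (induction I rule: finite_induct)
    case empty
    show ?case using linP[of 0 w 0 w] by simp
  next
    case (insert i I)
    then show ?case using linP[of "v i" "g i" 1] by simp
  qed
  have Q_sum: "Q (\<lambda>x. \<Sum>i\<in>I. v i * g i x) = (\<lambda>x. \<Sum>i\<in>I. v i * Q (g i) x)" if "finite I" for I :: "nat set" and v g
    using that
  proof (induction I rule: finite_induct)
    case empty
    show ?case using linQ[of 0 w 0 w] by simp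
  next
    case (insert i I)
    then show ?case using linQ[of "v i" "g i" 1] by simp
  qed
  have add: "\<Psi> (\<lambda>x. f x + g x) = (\<lambda>x. \<Psi> f x + \<Psi> g x)" for f g
    by (simp add: \<Psi>_def sum.distrib algebra_simps)
  have scale: "\<Psi> (\<lambda>x. k * f x) = (\<lambda>x. k * \<Psi> f x)" for k f
    by (simp add: \<Psi>_def sum_distrib_left algebra_simps)
  have \<Psi>supp: "d < i \<Longrightarrow> \<Psi> f i = 0" for f i by (simp add: \<Psi>_def usupp)
  have \<Psi>X: "\<Psi> (OX d (s * b) v) = P (\<Psi> v)" for v
  proof
    fix x
    have "P (\<Psi> v) x = (\<Sum>i\<le>d. v i * (?\<theta> i * u i x)) + (\<Sum>i\<le>d. v i * u (Suc i) x)"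
      by (simp add: \<Psi>_def P_sum Pu algebra_simps sum.distrib)
    \<comment> \<open>An index shift, whose surplus term at \<open>d + 1\<close> is 0 by
      \<open>uend\<close>.\<close>
    also have "(\<Sum>i\<le>d. v i * u (Suc i) x) = (\<Sum>i\<le>d. (if i \<ge> 1 then v (i - 1) else 0) * u i x)"
    proof -
      let ?g = "\<lambda>i. (if i \<ge> 1 then v (i - 1) else 0) * u i x"
      have "(\<Sum>i\<le>d. v i * u (Suc i) x) = (\<Sum>i\<le>d. ?g (Suc i))" by simp
      also have "\<dots> = (\<Sum>i\<le>Suc d. ?g i)" by (subst sum.atMost_Suc_shift) simp
      also have "\<dots> = (\<Sum>i\<le>d. ?g i)" using uend by (simp add: vzero_def)
      finally show ?thesis .
    qed
    finally show "\<Psi> (OX d (s * b) v) x = P (\<Psi> v) x"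
      unfolding \<Psi>_def OX_def sum.distrib[symmetric]
      by (simp add: algebra_simps)
  qed
  have \<Psi>Y: "\<Psi> (OY d (s * b) (s * c) a v) = Q (\<Psi> v)" for v
  proof
    fix x
    have "Q (\<Psi> v) x = (\<Sum>i\<le>d. v i * (?\<eta> i * u i x)) + (\<Sum>i\<le>d. v i * (?\<phi> i * u (i - 1) x))"
      by (simp add: \<Psi>_def Q_sum Qu algebra_simps sum.distrib)
    also have "(\<Sum>i\<le>d. v i * (?\<phi> i * u (i - 1) x)) = (\<Sum>i<d. v (Suc i) * (?\<phi> (Suc i) * u i x))"
      by (simp add: sum.atMost_shift)
    also have "\<dots> = (\<Sum>i\<le>d. if i < d then v (Suc i) * (?\<phi> (Suc i) * u i x) else 0)"
      by (simp add: lessThan_Suc_atMost[symmetric])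
    finally show "\<Psi> (OY d (s * b) (s * c) a v) x = Q (\<Psi> v) x"
      unfolding \<Psi>_def OY_def sum.distrib[symmetric]
      by (auto simp: algebra_simps intro!: sum.cong)
  qed
  have \<Psi>Z: "\<Psi> (OZ d (s * b) (s * c) a v) = OX d a (\<Psi> v)" for v
  proof
    fix x
    have "\<Psi> (OZ d (s * b) (s * c) a v) x = \<Psi> (OX d (s * b) (OY d (s * b) (s * c) a v)) x
         + \<Psi> (OY d (s * b) (s * c) a (OX d (s * b) v)) x - ?k * \<Psi> v x"
      by (simp add: \<Psi>_def OZ_def algebra_simps sum.distrib sum_subtractf sum_distrib_left)
    also have "\<dots> = P (Q (\<Psi> v)) x + Q (P (\<Psi> v)) x - ?k * \<Psi> v x"
      by (simp only: \<Psi>X \<Psi>Y)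
    also have "\<dots> = OX d a (\<Psi> v) x" using PQ[of "\<Psi> v" x, OF \<Psi>supp] by simp
    finally show "\<Psi> (OZ d (s * b) (s * c) a v) x = OX d a (\<Psi> v) x" .
  qed
  let ?M = "Omod d (s * b) (s * c) a"
  define N where "N = {v \<in> bcar ?M. \<Psi> v = vzero}"
  have P0: "P vzero = vzero" and Q0': "Q vzero = vzero" and R0: "OX d a vzero = vzero"
    using linP[of 0 w 0 w] linQ[of 0 w 0 w] linR[of 0 w 0 w] by (simp_all add: vzero_def)
  have sub: "bi_submodule N ?M"
    unfolding bi_submodule_def csubspace_of_def
    by (auto simp: N_def \<Psi>X \<Psi>Y \<Psi>Z P0 Q0' R0 add scale OX_out OY_out OZ_out)
      (auto simp: vzero_def \<Psi>_def)
  have "unitv 0 \<in> bcar ?M" "\<Psi> (unitv 0) \<noteq> vzero"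
  proof -
    have "\<Psi> (unitv 0) = w" by (simp add: \<Psi>_def unitv_def u0 if_distrib[of "\<lambda>z. z * _"] cong: if_cong)
    then show "\<Psi> (unitv 0) \<noteq> vzero" using wn by simp
  qed (simp add: unitv_def)
  then have "N \<noteq> bcar ?M" unfolding N_def by blast
  then have N: "N = {vzero}"
    using irr sub unfolding bi_irreducible_def by blast
  have inj: "f = vzero" if "\<And>i. d < i \<Longrightarrow> f i = 0" "\<Psi> f = vzero" for f
  proof -
    have "f \<in> N" using that by (simp add: N_def)
    then show ?thesis using N by simp
  qed
  have surj: "\<exists>f. (\<forall>i>d. f i = 0) \<and> \<Psi> f = y" if "\<And>i. d < i \<Longrightarrow> y i = 0" for y
    by (rule linear_inj_imp_surj[OF add scale \<Psi>supp inj that])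
  have "bij_betw \<Psi> {v. \<forall>i>d. v i = 0} {v. \<forall>i>d. v i = 0}"
    unfolding bij_betw_def
  proof
    show "inj_on \<Psi> {v. \<forall>i>d. v i = 0}"
    proof (rule inj_onI)
      fix f g assume fg: "f \<in> {v. \<forall>i>d. v i = 0}" "g \<in> {v. \<forall>i>d. v i = 0}" "\<Psi> f = \<Psi> g"
      have "\<Psi> (\<lambda>x. f x + (-1) * g x) = vzero"
        unfolding add scale fg(3) by (simp add: vzero_def)
      then have "(\<lambda>x. f x + (-1) * g x) = vzero" by (rule inj[rotated]) (use fg in auto)
      then show "f = g" by (simp add: vzero_def fun_eq_iff)
    qed
    show "\<Psi> ` {v. \<forall>i>d. v i = 0} = {v. \<forall>i>d. v i = 0}"
    proof (intro subset_antisym subsetI)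
      fix y :: "nat \<Rightarrow> complex" assume "y \<in> {v. \<forall>i>d. v i = 0}"
      then have "\<exists>f. (\<forall>i>d. f i = 0) \<and> \<Psi> f = y" by (intro surj) simp
      then show "y \<in> \<Psi> ` {v. \<forall>i>d. v i = 0}" by blast
    qed (use \<Psi>supp in auto)
  qed
  moreover have "\<Psi> (\<lambda>x. s * OX d (s * b) v x) = OY d a b c (\<Psi> v)"
    "\<Psi> (\<lambda>x. s * OY d (s * b) (s * c) a v x) = OZ d a b c (\<Psi> v)" for v
    by (simp_all add: scale \<Psi>X \<Psi>Y P_def Q_def mult.assoc[symmetric] ss)
  ultimately show ?thesis
    unfolding bi_isomorphic_def
    by (intro exI[of _ \<Psi>])
      (auto simp: clinear_on_def intertwines_def add scale \<Psi>Z ss)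
qed

subsection \<open>Restriction to \<open>x\<^sub>1 = 0\<close>\<close>

definition mon :: "nat \<Rightarrow> nat \<Rightarrow> nat \<Rightarrow> idx \<Rightarrow> nat" where
  "mon a b c = (\<lambda>i. case i of I1 \<Rightarrow> a | I2 \<Rightarrow> b | I3 \<Rightarrow> c)"

lemma mon_simps [simp]:
  "mon a b c I1 = a" "mon a b c I2 = b" "mon a b c I3 = c"
  "(mon a b c)(I1 := x) = mon x b c" "(mon a b c)(I2 := x) = mon a x c" "(mon a b c)(I3 := x) = mon a b x"
  "mdeg (mon a b c) = a + b + c"
  by (auto simp: mon_def mdeg_def fun_eq_iff split: idx.splits)

lemma mon_eq: "mon (m I1) (m I2) (m I3) = m"
  by (auto simp: mon_def fun_eq_iff split: idx.splits)

text \<open>The scalar in T_i x_i^m = \<open>dco k i m\<close> x_i^(m-1). For positive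
  \<open>m\<close> it vanishes exactly at \<open>m = t_i\<close>.\<close>

definition dco :: "(idx \<Rightarrow> real) \<Rightarrow> idx \<Rightarrow> nat \<Rightarrow> complex" where
  "dco k i m = of_nat m + (if odd m then 2 * complex_of_real (k i) else 0)"

lemma dunkl_eq: "dunkl k i p b = dco k i (Suc (b i)) * p (b(i := Suc (b i)))"
  by (simp add: dunkl_def dco_def)

definition sg :: "bool \<Rightarrow> complex" where
  "sg e = (if e then 1 else -1)"

lemma sg_simps [simp]: "sg True = 1" "sg False = -1" "sg (\<not> e) = - sg e" "sg e * sg e = 1" "sg e \<noteq> 0"
  by (auto simp: sg_def)

lemma pauli_simps:
  "pauli I1 f (s, b) = f (\<not> s, b)"
  "pauli I2 f (s, b) = - sg s * \<i> * f (\<not> s, b)"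
  "pauli I3 f (s, b) = sg s * f (s, b)"
  by (auto simp: pauli_def)

lemma lift_eq: "lift A f (s, b) = A (\<lambda>a. f (s, a)) b"
  by (simp add: lift_def)

lemma Dirac_mon:
  "Dirac k f (s, mon a b c) = dco k I1 (Suc a) * f (\<not> s, mon (Suc a) b c)
     - sg s * \<i> * dco k I2 (Suc b) * f (\<not> s, mon a (Suc b) c)
     + sg s * dco k I3 (Suc c) * f (s, mon a b (Suc c))"
  by (simp add: Dirac_def pauli_simps lift_eq dunkl_eq)

lemma Pn_zero: "f \<in> Pn n \<Longrightarrow> a + b + c \<noteq> n \<Longrightarrow> f (s, mon a b c) = 0"
  unfolding Pn_def by (metis (mono_tags, lifting) mem_Collect_eq mon_simps(7))

text \<open>The Dirac equation solved for the x_1-derivative, that is, multiplied by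
  \<open>e_1\<close>: a recursion in the power of x_1.\<close>

lemma Mn_step:
  assumes "f \<in> Mn k n"
  shows "dco k I1 (Suc a) * f (s, mon (Suc a) b c) =
     sg s * (dco k I3 (Suc c) * f (\<not> s, mon a b (Suc c)) - \<i> * dco k I2 (Suc b) * f (s, mon a (Suc b) c))"
proof -
  have "Dirac k f (\<not> s, mon a b c) = 0" using assms by (simp add: Mn_def vzero_def)
  then show ?thesis unfolding Dirac_mon by (simp add: algebra_simps)
qed

text \<open>The coefficient of \<open>x\<^sub>2\<close>-\<open>x\<^sub>3\<close>-degree \<open>(n - c, c)\<close> in the restriction to \<open>x\<^sub>1 = 0\<close>, projected to
  the eigenspace of \<open>e\<^sub>1\<close> with eigenvalue \<open>sg e\<close>.\<close>

definition face_coeff :: "nat \<Rightarrow> vpol \<Rightarrow> bool \<Rightarrow> nat \<Rightarrow> complex" where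
  "face_coeff n f e c = f (True, mon 0 (n - c) c) + sg e * f (False, mon 0 (n - c) c)"

lemma face_coeff_eq_iff:
  "(\<forall>e. face_coeff n f e c = face_coeff n g e c) \<longleftrightarrow> (\<forall>s. f (s, mon 0 (n - c) c) = g (s, mon 0 (n - c) c))"
  (is "?l \<longleftrightarrow> ?r")
proof
  assume l: ?l
  show ?r
  proof
    fix s
    have "2 * f (True, mon 0 (n - c) c) = 2 * g (True, mon 0 (n - c) c)"
      "2 * f (False, mon 0 (n - c) c) = 2 * g (False, mon 0 (n - c) c)"
      using spec[OF l, of True] spec[OF l, of False] by (simp_all add: face_coeff_def, algebra+)
    then show "f (s, mon 0 (n - c) c) = g (s, mon 0 (n - c) c)" by (cases s) simp_all
  qed
qed (simp add: face_coeff_def)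

text \<open>Induction on the power of x_1. A step at x_3-exponent \<open>c\<close> uses
  \<open>c\<close> and \<open>c + 1\<close>; the passage from \<open>t - 1\<close> to
  \<open>t\<close> has coefficient \<open>dco k I3 t = 0\<close> or exceeds the degree, so the
  exponents below \<open>t\<close> form a closed system.\<close>

lemma Mn_determined:
  assumes f: "f \<in> Mn k n" and g: "g \<in> Mn k n"
    and reg: "\<forall>m\<in>{1..n}. dco k I1 m \<noteq> 0"
    and t: "dco k I3 t = 0 \<or> n < t"
    and eq: "\<And>e c. c < t \<Longrightarrow> c \<le> n \<Longrightarrow> face_coeff n f e c = face_coeff n g e c"
    and "m I3 < t"
  shows "f (s, m) = g (s, m)"
proof -
  have P: "f \<in> Pn n" "g \<in> Pn n" using f g by (auto simp: Mn_def)
  have "f (s, mon a b c) = g (s, mon a b c)" if "c < t" for a b c s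
    using that
  proof (induction a arbitrary: b c s)
    case 0
    show ?case
    proof (cases "b + c = n")
      case True
      then have "\<forall>s. f (s, mon 0 (n - c) c) = g (s, mon 0 (n - c) c)"
        using eq[OF 0] by (intro iffD1[OF face_coeff_eq_iff]) auto
      then show ?thesis using True by auto
    qed (simp add: Pn_zero[OF P(1)] Pn_zero[OF P(2)])
  next
    case (Suc a)
    show ?case
    proof (cases "Suc a + b + c = n")
      case True
      have "dco k I3 (Suc c) * f (\<not> s, mon a b (Suc c)) = dco k I3 (Suc c) * g (\<not> s, mon a b (Suc c))"
      proof (cases "Suc c < t")
        case False
        then have "t = Suc c" using Suc.prems by simp
        then show ?thesis using t Suc.prems True by auto
      qed (simp add: Suc.IH)
      then have "dco k I1 (Suc a) * f (s, mon (Suc a) b c) = dco k I1 (Suc a) * g (s, mon (Suc a) b c)"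
        unfolding Mn_step[OF f] Mn_step[OF g] using Suc.IH[OF Suc.prems] by simp
      then show ?thesis using reg True by simp
    qed (simp add: Pn_zero[OF P(1)] Pn_zero[OF P(2)])
  qed
  then show ?thesis using assms(6) mon_eq[of m] by metis
qed

text \<open>Cauchy--Kovalevskaia extension: \<open>D f = 0\<close> determines the part of degree \<open>a + 1\<close> in \<open>x\<^sub>1\<close> from the
  part of degree \<open>a\<close>. The divisor is nonzero in all degrees that matter since \<open>n < t\<^sub>1\<close>.\<close>

primrec ck_ext :: "(idx \<Rightarrow> real) \<Rightarrow> (bool \<Rightarrow> nat \<Rightarrow> nat \<Rightarrow> complex) \<Rightarrow> nat \<Rightarrow> bool \<Rightarrow> nat \<Rightarrow> nat \<Rightarrow> complex" where
  "ck_ext k g 0 = g"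
| "ck_ext k g (Suc a) = (\<lambda>s b c. sg s * (dco k I3 (Suc c) * ck_ext k g a (\<not> s) b (Suc c)
      - \<i> * dco k I2 (Suc b) * ck_ext k g a s (Suc b) c) / dco k I1 (Suc a))"

lemma Mn_extension:
  assumes reg: "\<forall>m\<in>{1..n}. dco k I1 m \<noteq> 0"
  shows "\<exists>f\<in>Mn k n. \<forall>e. \<forall>c\<le>n. face_coeff n f e c = h e c"
proof -
  \<comment> \<open>The inverse of the projection to the two eigenspaces of \<open>e_1\<close>,
    extended by 0 outside degree \<open>n\<close>.\<close>
  define g where "g s b c = (if b + c = n then (h True c + sg s * h False c) / 2 else 0)" for s b c
  define f where "f = (\<lambda>(s, m). ck_ext k g (m I1) s (m I2) (m I3))"
  have ck0: "ck_ext k g a s b c = 0" if "a + b + c \<noteq> n" for a s b c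
    using that by (induction a arbitrary: s b c) (auto simp: g_def)
  have fmon: "f (s, mon a b c) = ck_ext k g a s b c" for s a b c by (simp add: f_def)
  have "f \<in> Pn n" using ck0 by (auto simp: Pn_def mdeg_def f_def)
  moreover have "Dirac k f (s, mon a b c) = 0" for s a b c
  \<comment> \<open>Every term vanishes unless the monomial has degree \<open>n - 1\<close>, and
    then the divisor in \<open>ck_ext\<close> is nonzero.\<close>
  proof (cases "Suc a + b + c = n")
    case True
    then have "dco k I1 (Suc a) \<noteq> 0" using reg by simp
    then show ?thesis unfolding Dirac_mon fmon by (simp add: field_simps)
  next
    case False
    then show ?thesis unfolding Dirac_mon fmon by (simp add: ck0)
  qed
  then have "Dirac k f = vzero" unfolding vzero_def fun_eq_iff by (metis mon_eq surj_pair)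
  moreover have "face_coeff n f e c = h e c" if "c \<le> n" for e c
    using that by (cases e) (simp_all add: face_coeff_def fmon g_def field_simps)
  ultimately show ?thesis by (auto simp: Mn_def)
qed

section \<open>The generators on the face x_1 = 0\<close>

lemmas bigen_simps = bigen_def Let_def pauli_simps Lop_def lift_eq mulx_def dunkl_eq refl_def

text \<open>Terms multiplied by x_1 vanish on the face. Of the angular part only x_3 T_1 remains,
  and \<open>Mn_step\<close> rewrites T_1 through T_2 and T_3; \<open>Z\<close> is treated alike
  with x_2 T_1.\<close>

lemma bigen_Y_mon:
  assumes "f \<in> Mn k n"
  shows "bigen k I2 I1 I3 I1 I3 f (s, mon 0 b c) =
     (-1) ^ c * (of_nat c + k I1 + k I3 + 1 / 2) * f (s, mon 0 b c)
     + (if c = 0 then 0 else \<i> * (-1) ^ (c - 1) * dco k I2 (Suc b) * f (\<not> s, mon 0 (Suc b) (c - 1)))"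
proof (cases c)
  case 0
  then show ?thesis by (simp add: bigen_simps algebra_simps)
next
  case (Suc m)
  have "bigen k I2 I1 I3 I1 I3 f (s, mon 0 b c) =
     sg s * (-1) ^ m * (dco k I1 (Suc 0) * f (\<not> s, mon (Suc 0) b m))
      + ((-1) ^ c * (k I1 + 1 / 2) + k I3) * f (s, mon 0 b c)"
    by (simp add: bigen_simps Suc algebra_simps)
  also have "\<dots> = (-1) ^ m * (\<i> * dco k I2 (Suc b) * f (\<not> s, mon 0 (Suc b) m))
      + ((-1) ^ c * (dco k I3 c + k I1 + 1 / 2) + k I3) * f (s, mon 0 b c)"
    unfolding Mn_step[OF assms] by (cases s) (simp_all add: Suc algebra_simps)
  also have "(-1) ^ c * (dco k I3 c + k I1 + 1 / 2) + k I3 = (-1) ^ c * (of_nat c + k I1 + k I3 + 1 / 2)"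
    by (cases "even c") (simp_all add: dco_def)
  finally show ?thesis by (simp add: Suc algebra_simps)
qed

lemma bigen_Z_mon:
  assumes "f \<in> Mn k n"
  shows "bigen k I3 I2 I1 I1 I2 f (s, mon 0 b c) =
     (-1) ^ b * (of_nat b + k I1 + k I2 + 1 / 2) * f (s, mon 0 b c)
     + (if b = 0 then 0 else \<i> * (-1) ^ b * dco k I3 (Suc c) * f (\<not> s, mon 0 (b - 1) (Suc c)))"
proof (cases b)
  case 0
  then show ?thesis by (simp add: bigen_simps algebra_simps)
next
  case (Suc m)
  have "bigen k I3 I2 I1 I1 I2 f (s, mon 0 b c) =
     \<i> * sg s * (-1) ^ b * (dco k I1 (Suc 0) * f (s, mon (Suc 0) m c))
      + ((-1) ^ b * (k I1 + 1 / 2) + k I2) * f (s, mon 0 b c)"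
    by (simp add: bigen_simps Suc algebra_simps)
  also have "\<dots> = (-1) ^ b * (\<i> * dco k I3 (Suc c) * f (\<not> s, mon 0 m (Suc c)))
      + ((-1) ^ b * (dco k I2 b + k I1 + 1 / 2) + k I2) * f (s, mon 0 b c)"
    unfolding Mn_step[OF assms] by (cases s) (simp_all add: Suc algebra_simps)
  also have "(-1) ^ b * (dco k I2 b + k I1 + 1 / 2) + k I2 = (-1) ^ b * (of_nat b + k I1 + k I2 + 1 / 2)"
    by (cases "even b") (simp_all add: dco_def)
  finally show ?thesis by (simp add: Suc algebra_simps)
qed

lemma bigen_X_mon:
  "bigen k I1 I3 I2 I2 I3 f (s, mon 0 b c) =
     (-1) ^ (b + c) * (f (s, mon 0 b c) / 2
        + \<i> * (if c = 0 then 0 else dco k I2 (Suc b) * f (\<not> s, mon 0 (Suc b) (c - 1)))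
        - \<i> * (if b = 0 then 0 else dco k I3 (Suc c) * f (\<not> s, mon 0 (b - 1) (Suc c))))
     + (k I2 * (-1) ^ c + k I3 * (-1) ^ b) * f (s, mon 0 b c)"
  by (cases b; cases c) (simp_all add: bigen_simps power_add algebra_simps)

text \<open>The swap of the two components is \<open>e_1\<close>, hence the scalar
  \<open>sg e\<close> after projection: the eigenspaces do not mix.\<close>

lemma face_coeff_Y:
  assumes "f \<in> Mn k n" and "c \<le> n"
  shows "face_coeff n (bigen k I2 I1 I3 I1 I3 f) e c =
     (-1) ^ c * (of_nat c + k I1 + k I3 + 1 / 2) * face_coeff n f e c
     + (if c = 0 then 0 else \<i> * sg e * (-1) ^ (c - 1) * dco k I2 (Suc (n - c)) * face_coeff n f e (c - 1))"
proof (cases c)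
  case (Suc m)
  then have "n - m = Suc (n - c)" using assms(2) by simp
  then show ?thesis using Suc
    by (cases e) (simp_all add: face_coeff_def bigen_Y_mon[OF assms(1)] algebra_simps)
qed (simp add: face_coeff_def bigen_Y_mon[OF assms(1)] algebra_simps)

lemma neg_one_power_diff: "odd n \<Longrightarrow> c \<le> n \<Longrightarrow> (-1) ^ (n - c) = - ((-1) ^ c :: complex)"
  by (cases "even c") (auto simp: )

lemma face_coeff_Z:
  assumes "f \<in> Mn k n" and "c \<le> n" and "odd n"
  shows "face_coeff n (bigen k I3 I2 I1 I1 I2 f) e c =
     - ((-1) ^ c) * (of_nat n - of_nat c + k I1 + k I2 + 1 / 2) * face_coeff n f e c
     - (if c = n then 0 else \<i> * sg e * (-1) ^ c * dco k I3 (Suc c) * face_coeff n f e (Suc c))"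
  using assms(2,3)
  by (cases e) (auto simp: face_coeff_def bigen_Z_mon[OF assms(1)] neg_one_power_diff of_nat_diff algebra_simps)

lemma face_coeff_X:
  assumes "c \<le> n" and "odd n"
  shows "face_coeff n (bigen k I1 I3 I2 I2 I3 f) e c =
     ((-1) ^ c * (k I2 - k I3) - 1 / 2) * face_coeff n f e c
     - (if c = 0 then 0 else \<i> * sg e * dco k I2 (Suc (n - c)) * face_coeff n f e (c - 1))
     + (if c = n then 0 else \<i> * sg e * dco k I3 (Suc c) * face_coeff n f e (Suc c))"
proof -
  have 3: "(-1) ^ (n - c + c) = (-1 :: complex)" using assms by simp
  show ?thesis
    by (cases e) (use assms in \<open>auto simp: face_coeff_def bigen_X_mon 3 Suc_diff_le neg_one_power_diff algebra_simps\<close>)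
qed

text \<open>\<open>v\<^bsub>i\<^esub> = basis_scale i \<cdot> x\<^sub>2\<^bsup>n-l-i\<^esup> x\<^sub>3\<^bsup>l+i\<^esup>\<close> on the face \<open>x\<^sub>1 = 0\<close> makes the subdiagonal entries of \<open>s Y\<close> equal
  to \<open>1\<close>.\<close>

primrec basis_scale :: "(idx \<Rightarrow> real) \<Rightarrow> nat \<Rightarrow> nat \<Rightarrow> complex \<Rightarrow> bool \<Rightarrow> nat \<Rightarrow> complex" where
  "basis_scale k n l s e 0 = 1"
| "basis_scale k n l s e (Suc i) = s * (\<i> * sg e * (-1) ^ (l + i) * dco k I2 (n - (l + i))) * basis_scale k n l s e i"

text \<open>Used with \<open>l = t3\<close>, \<open>d = n - t3\<close> for the submodule and
  \<open>l = 0\<close>, \<open>d = t3 - 1\<close> for the quotient. Coordinates divide by the scale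
  of the basis vectors and are 0 beyond \<open>d\<close>, as the carrier of \<open>Omod\<close>
  demands.\<close>

definition coord :: "(idx \<Rightarrow> real) \<Rightarrow> nat \<Rightarrow> nat \<Rightarrow> nat \<Rightarrow> complex \<Rightarrow> vpol \<Rightarrow> bool \<times> nat \<Rightarrow> complex" where
  "coord k n l d s f = (\<lambda>(e, i). if i \<le> d then face_coeff n f e (l + i) / basis_scale k n l s e i else 0)"

section \<open>Coordinates and the intertwining property\<close>

lemma basis_scale_nonzero:
  assumes "\<forall>m\<in>{1..n}. dco k I2 m \<noteq> 0" "s \<noteq> 0" "l + i \<le> n"
  shows "basis_scale k n l s e i \<noteq> 0"
  using assms(3) by (induction i) (use assms(1,2) in auto)

lemma coord_linear: "clinear_on V (coord k n l d s)"
  by (auto simp: clinear_on_def coord_def face_coeff_def fun_eq_iff add_divide_distrib distrib_left)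

lemma coord_bcar: "coord k n l d s f \<in> bcar (bi_dsum (twist (s, s) cyc132 (Omod d a b c)))"
  by (simp add: bi_dsum_def coord_def)

lemma coord_surj:
  assumes reg1: "\<forall>m\<in>{1..n}. dco k I1 m \<noteq> 0"
    and reg2: "\<forall>m\<in>{1..n}. dco k I2 m \<noteq> 0"
    and "s \<noteq> 0" "l + d \<le> n"
    and v: "v \<in> bcar (bi_dsum (twist (s, s) cyc132 (Omod d a b c)))"
  obtains f where "f \<in> Mn k n" "coord k n l d s f = v" "\<And>e i. i < l \<Longrightarrow> face_coeff n f e i = 0"
proof -
  \<comment> \<open>The entries below \<open>l\<close> are set to 0, which for \<open>l = t3\<close>
    puts the extension into the submodule.\<close>
  define h where "h e i = (if l \<le> i then basis_scale k n l s e (i - l) * v (e, i - l) else 0)" for e i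
  obtain f where f: "f \<in> Mn k n" "\<forall>e. \<forall>c\<le>n. face_coeff n f e c = h e c"
    using Mn_extension[OF reg1] by metis
  have "coord k n l d s f = v"
    unfolding fun_eq_iff split_paired_All
  proof (intro allI)
    fix e i
    show "coord k n l d s f (e, i) = v (e, i)"
      using v f(2) basis_scale_nonzero[OF reg2 \<open>s \<noteq> 0\<close>, where l = l and i = i and e = e] assms(4)
      by (auto simp: coord_def h_def bi_dsum_def)
  qed
  then show thesis using that[OF f(1)] f(2) assms(4) by (simp add: h_def)
qed

lemma rescale_lower:
  fixes q :: complex
  assumes "s * s = 1" "q \<noteq> 0" "\<nu> \<noteq> 0"
  shows "\<theta> * (g / (s * q * \<nu>)) + g' / \<nu> = s * ((s * \<theta> * g + q * g') / (s * q * \<nu>))"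
proof -
  have "s \<noteq> 0" using assms(1) by auto
  moreover have "s * (s * z) = z" for z using assms(1) by (simp add: mult.assoc[symmetric])
  ultimately show ?thesis using assms(2,3) by (simp add: field_simps)
qed

text \<open>\<open>s\<close> is its own inverse and that of \<open>t\<close> is \<open>-t\<close>,
  whence the minus sign. In the application \<open>t * D\<close> is the factor of
  \<open>basis_scale\<close>, and \<open>D * w\<close> is the superdiagonal entry \<phi>.\<close>

lemma rescale_upper:
  fixes t :: complex
  assumes "s * s = 1" "t * t = -1" "D \<noteq> 0" "\<nu> \<noteq> 0"
  shows "\<theta> * (g / \<nu>) + D * w * (g' / (s * (t * D) * \<nu>)) = s * ((s * \<theta> * g - t * w * g') / \<nu>)"
proof -
  have "t * (- t) = 1" using assms(2) by simp
  then have inv: "inverse s = s" "inverse t = - t" using assms(1) by (auto intro: inverse_unique)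
  have "D * w * (g' / (s * (t * D) * \<nu>)) = inverse s * inverse t * w * g' / \<nu>"
    using assms(3) by (simp add: field_simps)
  then have *: "D * w * (g' / (s * (t * D) * \<nu>)) = s * (- t * w * g' / \<nu>)"
    unfolding inv by (simp add: field_simps)
  have "\<theta> * (g / \<nu>) = (s * s) * (\<theta> * (g / \<nu>))" using assms(1) by simp
  then show ?thesis unfolding *
    by (simp add: diff_divide_distrib right_diff_distrib)
qed

text \<open>After the twist, \<open>Y\<close>, \<open>Z\<close>, \<open>X\<close> must become
  \<open>s * OX\<close>, \<open>s * OY\<close>, \<open>OZ\<close>. The conditions \<open>low\<close>
  and \<open>top\<close> cut the band at both ends, \<open>a\<close> and \<open>b\<close> match the
  diagonals of \<open>Y\<close> and \<open>Z\<close>, \<open>c\<close> that of \<open>X\<close>, and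
  \<phi> is the product of opposite off-diagonal entries.\<close>

lemma coord_intertwines:
  fixes a b c s :: complex
  assumes n: "odd n" and d: "even d" and s: "s = (-1) ^ l"
    and reg2: "\<forall>m\<in>{1..n}. dco k I2 m \<noteq> 0"
    and ld: "l + d \<le> n" and top: "l + d = n \<or> dco k I3 (Suc (l + d)) = 0"
    and V: "V \<subseteq> Mn k n" and low: "\<And>f e. f \<in> V \<Longrightarrow> l \<noteq> 0 \<Longrightarrow> face_coeff n f e (l - 1) = 0"
    and a: "a = of_nat d / 2 + of_nat l + k I1 + k I3 + 1 / 2"
    and b: "b = of_nat d / 2 + of_nat l - of_nat n - k I1 - k I2 - 1 / 2"
    and c: "c = s * (k I2 - k I3) - of_nat d / 2 - 1 / 2"
    and phi: "\<And>i. i < d \<Longrightarrow> Ophi d a b c (Suc i) = dco k I2 (n - (l + i)) * dco k I3 (Suc (l + i))"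
  shows "intertwines (polymod k V) (bi_dsum (twist (s, s) cyc132 (Omod d a b c))) (coord k n l d s)"
proof -
  let ?\<psi> = "coord k n l d s"
  have ss: "s * s = 1" and s0: "s \<noteq> 0" by (auto simp: s)
  let ?Y = "bigen k I2 I1 I3 I1 I3" and ?Z = "bigen k I3 I2 I1 I1 I2" and ?X = "bigen k I1 I3 I2 I2 I3"
  have par: "(-1) ^ (l + i) = s * (-1) ^ i" for i by (simp add: s power_add)
  have nz: "i \<le> d \<Longrightarrow> basis_scale k n l s e i \<noteq> 0" for e i
    using basis_scale_nonzero[OF reg2 s0, where l = l and i = i and e = e] ld by simp
  have th1: "Otheta d a i = (-1) ^ i * (of_nat (l + i) + k I1 + k I3 + 1 / 2)" for i
    by (simp add: Otheta_def a field_simps)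
  have th2: "Otheta d b i = - ((-1) ^ i) * (of_nat n - of_nat (l + i) + k I1 + k I2 + 1 / 2)" for i
    by (simp add: Otheta_def b field_simps)
  have X: "OX d a (\<lambda>i. ?\<psi> f (e, i)) i = s * ?\<psi> (?Y f) (e, i)" if f: "f \<in> V" for f e i
  proof (cases "i \<le> d")
    case i: True
    have M: "f \<in> Mn k n" and c': "l + i \<le> n" using f V i ld by auto
    show ?thesis
    proof (cases i)
      case 0
      have "face_coeff n (?Y f) e (l + i) = (-1) ^ l * (of_nat (l + i) + k I1 + k I3 + 1 / 2) * face_coeff n f e l"
        using face_coeff_Y[OF M, of "l + i" e] c' low[OF f, of e] by (auto simp: 0)
      then show ?thesis
        by (simp add: 0 OX_0 th1 coord_def flip: s) (simp add: mult.assoc[symmetric] ss)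
    next
      case (Suc j)
      have nj: "Suc (n - (l + i)) = n - (l + j)" using c' Suc by simp
      let ?q = "\<i> * sg e * (-1) ^ (l + j) * dco k I2 (n - (l + j))"
      have GY: "face_coeff n (?Y f) e (l + i) = s * Otheta d a i * face_coeff n f e (l + i) + ?q * face_coeff n f e (l + j)"
        using face_coeff_Y[OF M c', of e] unfolding par th1 by (simp add: par[symmetric] nj[symmetric] Suc)
      have "?q \<noteq> 0" using reg2 c' Suc by simp
      then have "Otheta d a i * (face_coeff n f e (l + i) / (s * ?q * basis_scale k n l s e j)) + face_coeff n f e (l + j) / basis_scale k n l s e j
          = s * (face_coeff n (?Y f) e (l + i) / (s * ?q * basis_scale k n l s e j))"
        unfolding GY by (rule rescale_lower[OF ss]) (use nz[of j e] i Suc in simp)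
      then show ?thesis using i Suc by (simp add: OX_Suc coord_def)
    qed
  qed (simp add: OX_out coord_def)
  have Y: "OY d a b c (\<lambda>i. ?\<psi> f (e, i)) i = s * ?\<psi> (?Z f) (e, i)" if f: "f \<in> V" for f e i
  proof (cases "i \<le> d")
    case i: True
    have M: "f \<in> Mn k n" and c': "l + i \<le> n" using f V i ld by auto
    have Z: "face_coeff n (?Z f) e (l + i) = - (s * (-1) ^ i) * (of_nat n - of_nat (l + i) + k I1 + k I2 + 1 / 2) * face_coeff n f e (l + i)
          - (if i = d then 0 else \<i> * sg e * (-1) ^ (l + i) * dco k I3 (Suc (l + i)) * face_coeff n f e (Suc (l + i)))"
      using face_coeff_Z[OF M c' n, of e] top ld i by (auto simp: par)
    show ?thesis
    proof (cases "i = d")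
      case True
      then show ?thesis using Z
        by (simp add: OY_def th2 coord_def) (simp add: mult.assoc[symmetric] ss)
    next
      case False
      then have i: "i < d" using i by simp
      let ?t = "\<i> * sg e * (-1) ^ (l + i)" and ?D = "dco k I2 (n - (l + i))"
      have GZ: "face_coeff n (?Z f) e (l + i) = s * Otheta d b i * face_coeff n f e (l + i)
          - ?t * dco k I3 (Suc (l + i)) * face_coeff n f e (Suc (l + i))"
        using Z i unfolding th2 by simp
      have tt: "?t * ?t = -1"
        by (cases e; cases "even (l + i)") simp_all
      have "?D \<noteq> 0" using reg2 ld i by simp
      then have "Otheta d b i * (face_coeff n f e (l + i) / basis_scale k n l s e i)
            + ?D * dco k I3 (Suc (l + i)) * (face_coeff n f e (Suc (l + i)) / (s * (?t * ?D) * basis_scale k n l s e i))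
          = s * (face_coeff n (?Z f) e (l + i) / basis_scale k n l s e i)"
        unfolding GZ by (rule rescale_upper[OF ss tt]) (use nz[of i e] i in simp)
      then show ?thesis using i by (simp add: OY_def phi coord_def)
    qed
  qed (simp add: OY_out coord_def)
  have Z: "OZ d a b c (\<lambda>i. ?\<psi> f (e, i)) i = ?\<psi> (?X f) (e, i)" if f: "f \<in> V" for f e i
  proof (cases "i \<le> d")
    case i: True
    have M: "f \<in> Mn k n" and c': "l + i \<le> n" using f V i ld by auto
    have s2: "s * (s * z) = z" for z using ss by (simp add: mult.assoc[symmetric])
    \<comment> \<open>The off-diagonal terms \<open>T\<close>, \<open>U\<close> of \<open>X\<close>
      recur up to sign in \<open>Y\<close> and \<open>Z\<close>; naming them lets the row formula
      \<open>OZ_eq\<close> be checked on the face by plain algebra.\<close>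
    define T where "T = (if l + i = 0 then 0
      else \<i> * sg e * dco k I2 (Suc (n - (l + i))) * face_coeff n f e (l + i - 1))"
    define U where "U = (if l + i = n then 0
      else \<i> * sg e * dco k I3 (Suc (l + i)) * face_coeff n f e (Suc (l + i)))"
    have T: "(if l + i = 0 then 0 else \<i> * sg e * (-1) ^ (l + i - 1) * dco k I2 (Suc (n - (l + i)))
        * face_coeff n f e (l + i - 1)) = - (s * (-1) ^ i) * T"
      unfolding T_def par[symmetric] by (cases "l + i") simp_all
    have U: "(if l + i = n then 0 else \<i> * sg e * (-1) ^ (l + i) * dco k I3 (Suc (l + i))
        * face_coeff n f e (Suc (l + i))) = s * (-1) ^ i * U"
      unfolding U_def par[symmetric] by simp
    have "face_coeff n (?X f) e (l + i) = (if even i then s * face_coeff n (?Y f) e (l + i) - s * face_coeff n (?Z f) e (l + i) + (b - a + c + of_nat d / 2) * face_coeff n f e (l + i)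
           else s * face_coeff n (?Z f) e (l + i) - s * face_coeff n (?Y f) e (l + i) + (b - a - c - of_nat d / 2 - 1) * face_coeff n f e (l + i))"
      unfolding face_coeff_X[OF c' n] face_coeff_Y[OF M c'] face_coeff_Z[OF M c' n] T U T_def[symmetric] U_def[symmetric]
      unfolding a b c par
      by (cases "even i") (simp_all add: s2 ss algebra_simps)
    then show ?thesis using i unfolding OZ_eq[OF d i] X[OF f] Y[OF f]
      by (simp add: coord_def diff_divide_distrib add_divide_distrib)
  qed (simp add: OZ_out coord_def)
  show ?thesis
    unfolding intertwines_def
    by (auto simp: polymod_def bi_dsum_def fun_eq_iff X Y Z mult.assoc[symmetric] ss)
qed

text \<open>Over the reals each condition can be settled by the sign of a linear form.\<close>

lemma Omod_irreducible_real:
  fixes a b c :: real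
  assumes d: "even d"
    and odd: "\<And>s. odd s \<Longrightarrow> s \<le> d \<Longrightarrow> d + 1 - 2 * real s - 2 * a - 2 * b + 2 * c \<noteq> 0 \<and>
                s + 2 * b \<noteq> 0 \<and> 2 * s + 2 * (c - a + b) - d - 1 \<noteq> 0"
    and ev: "\<And>s. even s \<Longrightarrow> 1 \<le> s \<Longrightarrow> s \<le> d \<Longrightarrow> d + 1 - 2 * real s - 2 * a - 2 * b - 2 * c \<noteq> 0 \<and>
                s + 2 * b - d - 1 \<noteq> 0 \<and> 2 * s + 2 * (b - a - c) - d - 1 \<noteq> 0"
  shows "bi_irreducible (Omod d (of_real a) (of_real b) (of_real c))"
proof (rule Omod_irreducible[OF d])
  have nz: "z \<noteq> 0" if "z = complex_of_real r" "r \<noteq> 0" for z r using that by simp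
  fix s :: nat
  show "Ophi d (of_real a) (of_real b) (of_real c) s \<noteq> 0" if "1 \<le> s" "s \<le> d"
  proof (cases "even s")
    case True
    show ?thesis
      by (rule nz[of _ "s * (d + 1 - 2 * real s - 2 * a - 2 * b - 2 * c) / 2"])
        (use True ev[of s] that in \<open>auto simp: Ophi_def\<close>)
  next
    case False
    show ?thesis
      by (rule nz[of _ "(real s - d - 1) * (d + 1 - 2 * real s - 2 * a - 2 * b + 2 * c) / 2"])
        (use False odd[of s] that in \<open>auto simp: Ophi_def\<close>)
  qed
  show "of_nat s + 2 * complex_of_real b \<noteq> 0 \<and>
      2 * of_nat s + 2 * (complex_of_real c - of_real a + of_real b) - of_nat d - 1 \<noteq> 0" if "odd s" "s \<le> d"
    using odd[OF that]
    by (intro conjI nz[of _ "s + 2 * b"] nz[of _ "2 * s + 2 * (c - a + b) - d - 1"]) auto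
  show "of_nat s + 2 * complex_of_real b - of_nat d - 1 \<noteq> 0 \<and>
      2 * of_nat s + 2 * (complex_of_real b - of_real a - of_real c) - of_nat d - 1 \<noteq> 0"
    if "even s" "1 \<le> s" "s \<le> d"
    using ev[OF that]
    by (intro conjI nz[of _ "s + 2 * b - d - 1"] nz[of _ "2 * s + 2 * (b - a - c) - d - 1"]) auto
qed

section \<open>The thresholds t_i and the submodule M_n(x_3)\<close>

lemma tt_eq: "odd m \<Longrightarrow> 2 * k i = - real m \<Longrightarrow> tt k i = enat m"
proof -
  assume m: "odd m" "2 * k i = - real m"
  have "\<lfloor>- real m\<rfloor> = - int m" by (metis floor_of_int of_int_minus of_int_of_nat_eq)
  then show "tt k i = enat m" using m unfolding tt_def by auto
qed

lemma tt_finite: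
  assumes "tt k i = enat t"
  shows "odd t" "2 * k i = - real t"
proof -
  obtain m where "odd m" "2 * k i = - real m"
    using assms unfolding tt_def by (auto split: if_splits)
  moreover from this have "m = t" using assms tt_eq[of m k i] by simp
  ultimately show "odd t" "2 * k i = - real t" by auto
qed

lemma dco_eq_0_iff: "0 < m \<Longrightarrow> dco k i m = 0 \<longleftrightarrow> odd m \<and> 2 * k i = - real m"
proof -
  assume "0 < m"
  have "dco k i m = complex_of_real (real m + (if odd m then 2 * k i else 0))"
    by (simp add: dco_def)
  then show ?thesis using \<open>0 < m\<close> by (simp only: of_real_eq_0_iff) auto
qed

lemma dco_nonzero:
  assumes "enat n < tt k i"
  shows "\<forall>m\<in>{1..n}. dco k i m \<noteq> 0"
proof
  fix m assume "m \<in> {1..n}"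
  then show "dco k i m \<noteq> 0" using assms tt_eq[of m k i] by (auto simp: dco_eq_0_iff)
qed

text \<open>For the converse, comparison with the zero vector by \<open>Mn_determined\<close> at
  threshold \<open>t\<close> spreads the vanishing from the face to all powers of x_1.\<close>

lemma Mnx_I3_iff:
  assumes "tt k I3 = enat t" "t \<le> n" and reg: "\<forall>m\<in>{1..n}. dco k I1 m \<noteq> 0"
  shows "f \<in> Mnx k n I3 \<longleftrightarrow> f \<in> Mn k n \<and> (\<forall>e. \<forall>c<t. face_coeff n f e c = 0)"
proof
  assume f: "f \<in> Mnx k n I3"
  then have "f (s, mon 0 (n - c) c) = 0" if "c < t" for s c
    using assms(1) that by (force simp: Mnx_def)
  then show "f \<in> Mn k n \<and> (\<forall>e. \<forall>c<t. face_coeff n f e c = 0)"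
    using f by (simp add: Mnx_def face_coeff_def)
next
  assume f: "f \<in> Mn k n \<and> (\<forall>e. \<forall>c<t. face_coeff n f e c = 0)"
  have t: "odd t" "2 * k I3 = - real t" using tt_finite[OF assms(1)] by auto
  then have "dco k I3 t = 0" using dco_eq_0_iff[of t k I3] odd_pos by blast
  moreover have "vzero \<in> Mn k n"
    by (auto simp: Mn_def Pn_def vzero_def Dirac_def pauli_def lift_def dunkl_def fun_eq_iff split: idx.splits)
  moreover have "face_coeff n vzero e c = 0" for e c by (simp add: face_coeff_def vzero_def)
  ultimately have "f (s, a) = vzero (s, a)" if "a I3 < t" for s a
    using Mn_determined[of f k n vzero t a s] f reg that by simp
  then show "f \<in> Mnx k n I3"
    using f assms(1) by (auto simp: Mnx_def vzero_def not_less[symmetric])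
qed

theorem theorem7p3:
  fixes k :: "idx \<Rightarrow> real" and n t3 :: nat
  assumes "odd n"
    and "tt k I3 = enat t3" and "t3 \<le> n"
    and "enat n < tt k I1" and "enat n < tt k I2"
  defines "K \<equiv> complex_of_real (k I1 + k I2 + k I3)"
  defines "W1 \<equiv> twist (-1, -1) cyc132
             (Omod (n - t3) (complex_of_real (k I1) + (of_nat n + 1) / 2)
                            (- K - (of_nat n + 1) / 2)
                            (- complex_of_real (k I2) - (of_nat n + 1) / 2))"
  defines "W2 \<equiv> twist (1, 1) cyc132
             (Omod (t3 - 1) (complex_of_real (k I1)) (- K - of_nat n - 1) (complex_of_real (k I2)))"
  shows "bi_isomorphic (polymod k (Mnx k n I3)) (bi_dsum W1)
       \<and> bi_quotient_isomorphic (polymod k (Mn k n)) (Mnx k n I3) (bi_dsum W2)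
       \<and> (k I1 \<ge> 0 \<and> k I2 \<ge> 0 \<longrightarrow>
            bi_irreducible W1 \<and> bi_irreducible W2
          \<and> bi_isomorphic W1 (Omod (n - t3) (- complex_of_real (k I2) - (of_nat n + 1) / 2)
                                            (- complex_of_real (k I1) - (of_nat n + 1) / 2)
                                            (K + (of_nat n + 1) / 2))
          \<and> bi_isomorphic W2 (Omod (t3 - 1) (complex_of_real (k I2)) (complex_of_real (k I1))
                                            (- K - of_nat n - 1)))"
proof -
  note n = \<open>odd n\<close>
  have t3: "odd t3" "2 * k I3 = - real t3" using tt_finite[OF assms(2)] by auto
  then have t3': "complex_of_real (k I3) = - of_nat t3 / 2" "1 \<le> t3"
    by (auto simp: complex_eq_iff odd_pos Suc_le_eq)
  have reg1: "\<forall>m\<in>{1..n}. dco k I1 m \<noteq> 0" and reg2: "\<forall>m\<in>{1..n}. dco k I2 m \<noteq> 0"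
    using dco_nonzero assms(4,5) by blast+
  have dt: "dco k I3 t3 = 0" using t3 t3'(2) dco_eq_0_iff[of t3 k I3] by simp
  note Mnx = Mnx_I3_iff[OF assms(2,3) reg1]
  have d1: "even (n - t3)" and d2: "even (t3 - 1)" using n t3 \<open>t3 \<le> n\<close> by auto
  have dn1: "of_nat (n - t3) = (of_nat n - of_nat t3 :: complex)"
    and dn2: "of_nat (t3 - Suc 0) = (of_nat t3 - 1 :: complex)"
    using \<open>t3 \<le> n\<close> t3'(2) by (simp_all add: of_nat_diff)
  \<comment> \<open>The sign is \<open>(-1)^l\<close>: it is -1 for \<open>l = t3\<close>, which is
    odd, and 1 for \<open>l = 0\<close>.\<close>
  let ?\<psi>1 = "coord k n t3 (n - t3) (-1)" and ?\<psi>2 = "coord k n 0 (t3 - 1) 1"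
  have nz1: "i \<le> n - t3 \<Longrightarrow> basis_scale k n t3 (-1) e i \<noteq> 0" for e i
    using basis_scale_nonzero[OF reg2, of "-1" t3 i e] \<open>t3 \<le> n\<close> by simp
  have nz2: "i \<le> t3 - 1 \<Longrightarrow> basis_scale k n 0 1 e i \<noteq> 0" for e i
    using basis_scale_nonzero[OF reg2, of 1 0 i e] \<open>t3 \<le> n\<close> by simp
  have int1: "intertwines (polymod k (Mnx k n I3)) (bi_dsum W1) ?\<psi>1"
    unfolding W1_def
  proof (rule coord_intertwines[OF n d1 _ reg2])
    show "face_coeff n f e (t3 - 1) = 0" if "f \<in> Mnx k n I3" for f e
      using that t3'(2) by (simp add: Mnx)
    show "Ophi (n - t3) (complex_of_real (k I1) + (of_nat n + 1) / 2) (- K - (of_nat n + 1) / 2)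
        (- complex_of_real (k I2) - (of_nat n + 1) / 2) (Suc i)
        = dco k I2 (n - (t3 + i)) * dco k I3 (Suc (t3 + i))" if i: "i < n - t3" for i
    proof -
      \<comment> \<open>This removes truncated subtraction. As \<open>n\<close> and
        \<open>t3\<close> are odd, \<open>m\<close> has the parity of \<open>i\<close>, so one case
        distinction settles both factors.\<close>
      define m where "m = n - (t3 + i)"
      then have nm: "n = t3 + i + m" using i by simp
      then have "of_nat n = (of_nat t3 + of_nat i + of_nat m :: complex)" by simp
      moreover have "odd m = odd i" using nm n t3(1) by auto
      ultimately show ?thesis unfolding m_def[symmetric]
        using t3(1) by (cases "even i") (simp_all add: Ophi_def dco_def K_def dn1 t3' field_simps)
    qed
  qed (use \<open>t3 \<le> n\<close> t3(1) Mnx in \<open>auto simp: K_def dn1 t3' field_simps\<close>)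
  have int2: "intertwines (polymod k (Mn k n)) (bi_dsum W2) ?\<psi>2"
    unfolding W2_def
  proof (rule coord_intertwines[OF n d2 _ reg2])
    show "Ophi (t3 - 1) (k I1) (- K - of_nat n - 1) (k I2) (Suc i)
        = dco k I2 (n - (0 + i)) * dco k I3 (Suc (0 + i))" if i: "i < t3 - 1" for i
    proof -
      define m where "m = n - (0 + i)"
      then have nm: "n = i + m" using i \<open>t3 \<le> n\<close> by simp
      then have "of_nat n = (of_nat i + of_nat m :: complex)" by simp
      moreover have "odd m = even i" using nm n by auto
      ultimately show ?thesis unfolding m_def[symmetric]
        by (cases "even i") (simp_all add: Ophi_def dco_def K_def dn2 t3' field_simps)
    qed
  qed (use \<open>t3 \<le> n\<close> t3(1) t3'(2) dt in \<open>auto simp: K_def dn2 t3' field_simps\<close>)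
  have iso1: "bi_isomorphic (polymod k (Mnx k n I3)) (bi_dsum W1)"
    unfolding bi_isomorphic_def
  proof (intro exI conjI)
    show "bij_betw ?\<psi>1 (bcar (polymod k (Mnx k n I3))) (bcar (bi_dsum W1))"
      unfolding bij_betw_def
    proof
      show "inj_on ?\<psi>1 (bcar (polymod k (Mnx k n I3)))"
      proof (rule inj_onI)
        fix f g
        assume "f \<in> bcar (polymod k (Mnx k n I3))" "g \<in> bcar (polymod k (Mnx k n I3))"
          and eq: "?\<psi>1 f = ?\<psi>1 g"
        then have f: "f \<in> Mnx k n I3" and g: "g \<in> Mnx k n I3" by (auto simp: polymod_def)
        have "face_coeff n f e c = face_coeff n g e c" if "c \<le> n" for e c
        proof (cases "c < t3")
          case False
          then show ?thesis using fun_cong[OF eq, of "(e, c - t3)"] nz1[of "c - t3" e] that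
            by (simp add: coord_def diff_le_mono)
        qed (use f g in \<open>simp add: Mnx\<close>)
        \<comment> \<open>Threshold \<open>n + 1\<close>: equality on the whole face gives equality
          everywhere.\<close>
        then have "f (s, m) = g (s, m)" if "m I3 < Suc n" for s m
          using Mn_determined[OF _ _ reg1, of f g "Suc n" m s] f g that by (simp add: Mnx)
        moreover have "f (s, m) = g (s, m)" if "\<not> m I3 < Suc n" for s m
          using f g that unfolding Mnx_def Mn_def Pn_def mdeg_def
          by (smt (verit) add_leE le_refl less_Suc_eq_le mem_Collect_eq)
        ultimately show "f = g" by (metis surj_pair ext)
      qed
      show "?\<psi>1 ` bcar (polymod k (Mnx k n I3)) = bcar (bi_dsum W1)"
      proof (intro subset_antisym subsetI)
        fix v assume "v \<in> bcar (bi_dsum W1)"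
        then obtain f where "f \<in> Mn k n" "?\<psi>1 f = v" "\<And>e i. i < t3 \<Longrightarrow> face_coeff n f e i = 0"
          unfolding W1_def using \<open>t3 \<le> n\<close>
          by (elim coord_surj[OF reg1 reg2, rotated 2]) auto
        then show "v \<in> ?\<psi>1 ` bcar (polymod k (Mnx k n I3))"
          by (auto simp: polymod_def Mnx)
      qed (auto simp: W1_def coord_bcar)
    qed
  qed (rule coord_linear int1)+
  have iso2: "bi_quotient_isomorphic (polymod k (Mn k n)) (Mnx k n I3) (bi_dsum W2)"
    unfolding bi_quotient_isomorphic_def
  proof (intro exI conjI)
    show "?\<psi>2 ` bcar (polymod k (Mn k n)) = bcar (bi_dsum W2)"
    proof (intro subset_antisym subsetI)
      fix v assume "v \<in> bcar (bi_dsum W2)"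
      then obtain f where "f \<in> Mn k n" "?\<psi>2 f = v"
        unfolding W2_def using \<open>t3 \<le> n\<close>
        by (elim coord_surj[OF reg1 reg2, rotated 2]) auto
      then show "v \<in> ?\<psi>2 ` bcar (polymod k (Mn k n))"
        by (auto simp: polymod_def)
    qed (auto simp: W2_def coord_bcar)
    have "?\<psi>2 f = vzero \<longleftrightarrow> (\<forall>e. \<forall>c<t3. face_coeff n f e c = 0)" for f
    proof
      assume z: "?\<psi>2 f = vzero"
      show "\<forall>e. \<forall>c<t3. face_coeff n f e c = 0"
      proof (intro allI impI)
        fix e c assume "c < t3"
        then have "c \<le> t3 - 1" by simp
        then show "face_coeff n f e c = 0"
          using fun_cong[OF z, of "(e, c)"] nz2[of c e] by (simp add: coord_def vzero_def)
      qed
    next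
      assume "\<forall>e. \<forall>c<t3. face_coeff n f e c = 0"
      then show "?\<psi>2 f = vzero" using t3'(2) by (auto simp: coord_def vzero_def fun_eq_iff)
    qed
    then show "{v \<in> bcar (polymod k (Mn k n)). ?\<psi>2 v = vzero} = Mnx k n I3"
      by (auto simp: polymod_def Mnx)
  qed (rule coord_linear int2)+
  have rest: "bi_irreducible W1 \<and> bi_irreducible W2
          \<and> bi_isomorphic W1 (Omod (n - t3) (- complex_of_real (k I2) - (of_nat n + 1) / 2)
                                            (- complex_of_real (k I1) - (of_nat n + 1) / 2)
                                            (K + (of_nat n + 1) / 2))
          \<and> bi_isomorphic W2 (Omod (t3 - 1) (complex_of_real (k I2)) (complex_of_real (k I1))
                                            (- K - of_nat n - 1))" if k: "k I1 \<ge> 0" "k I2 \<ge> 0"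
  proof -
    have rd: "real (n - t3) = real n - real t3" "real (t3 - 1) = real t3 - 1"
      using \<open>t3 \<le> n\<close> t3'(2) by (simp_all add: of_nat_diff)
    have tn: "real t3 \<le> real n" "1 \<le> real t3" using \<open>t3 \<le> n\<close> t3'(2) by simp_all
    \<comment> \<open>After substituting \<open>2 * k I3 = - t3\<close>, each linear form has a
      strict sign for \<open>k I1, k I2 \<ge> 0\<close> and \<open>s\<close> in the given
      range.\<close>
    have "bi_irreducible (Omod (n - t3) (of_real (k I1 + (real n + 1) / 2)) (of_real (- (k I1 + k I2 + k I3) - (real n + 1) / 2))
        (of_real (- k I2 - (real n + 1) / 2)))"
    proof (rule Omod_irreducible_real[OF d1], goal_cases)
      case (1 s)
      then have "real s \<le> real n - real t3" using rd by linarith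
      then show ?case using rd k t3(2) tn by (simp add: field_simps)
    next
      case (2 s)
      then have "real s \<le> real n - real t3" using rd by linarith
      then show ?case using rd k t3(2) tn by (simp add: field_simps)
    qed
    then have i1: "bi_irreducible (Omod (n - t3) (complex_of_real (k I1) + (of_nat n + 1) / 2)
                            (- K - (of_nat n + 1) / 2)
                            (- complex_of_real (k I2) - (of_nat n + 1) / 2))"
      by (simp add: K_def)
    have "bi_irreducible (Omod (t3 - 1) (of_real (k I1)) (of_real (- (k I1 + k I2 + k I3) - n - 1)) (of_real (k I2)))"
    proof (rule Omod_irreducible_real[OF d2], goal_cases)
      case (1 s)
      then have "real s \<le> real t3 - 1" using rd by linarith
      then show ?case using rd k t3(2) tn by (simp add: field_simps)
    next
      case (2 s)
      then have "real s \<le> real t3 - 1" using rd by linarith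
      then show ?case using rd k t3(2) tn by (simp add: field_simps)
    qed
    then have i2: "bi_irreducible (Omod (t3 - 1) (complex_of_real (k I1)) (- K - of_nat n - 1) (complex_of_real (k I2)))"
      by (simp add: K_def)
    \<comment> \<open>With \<open>a\<close>, \<open>b\<close>, \<open>c\<close> the parameters of
      the asserted module, \<open>s * b\<close>, \<open>s * c\<close>, \<open>a\<close> are those of
      \<open>W1\<close> for \<open>s = -1\<close> and of \<open>W2\<close> for
      \<open>s = 1\<close>.\<close>
    show ?thesis
      using bi_irreducible_twist[OF i1, of "-1" "-1"] bi_irreducible_twist[OF i2, of 1 1]
        twist_cyc_isomorphic[OF d1, of "-1" "- complex_of_real (k I1) - (of_nat n + 1) / 2" "K + (of_nat n + 1) / 2"
          "- complex_of_real (k I2) - (of_nat n + 1) / 2"]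
        twist_cyc_isomorphic[OF d2, of 1 "complex_of_real (k I1)" "- K - of_nat n - 1" "complex_of_real (k I2)"] i1 i2
      by (simp add: W1_def W2_def add.commute[of "(of_nat n + 1) / 2" "complex_of_real (k I1)"])
  qed
  show ?thesis using iso1 iso2 rest by blast
qed

end
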